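(* Let $F$ be a field of characteristic zero, $r\ge 1$, $G=\mathbb{Z}^r$, and consider $UT_{2r}(F)$ with the finest grading and the symplectic involution $s$. Then, as $n\to\infty$, $$c_n^{G,\ast}(UT_{2r}(F))\sim\left(\frac{1}{2^r r^{2r-1}}\right)n^{2r-1}(2r)^n.$$ In particular, $\mathrm{exp}^{G,\ast}(UT_{2r}(F))=2r$.
   Context: $UT_{2r}(F)$ is the algebra of $2r\times 2r$ upper triangular matrices, with elementary matrices $E_{i,j}$, $i\le j$. The finest grading on $UT_{2r}(F)$ is the $\mathbb{Z}^r$-grading with $\deg E_{i,j}=g_i-g_j$, where $(g_1,\dots,g_{2r})=(e_1,\dots,e_r,0,e_r-e_{r-1},\dots,e_r-e_1)$ and $e_1,\dots,e_r$ is the standard basis of $\mathbb{Z}^r$. The reflection involution is the linear map with $E_{i,j}^\ast=E_{2r+1-j,2r+1-i}$; the symplectic involution is $a^s=Da^\ast D^{-1}$ with $D=\mathrm{diag}(I_r,-I_r)$; it preserves each homogeneous component. For a $G$-graded algebra $A=\oplus_gA_g$ with involution $a\mapsto a^\ast$ preserving each $A_g$: $F_{G,\ast}\langle X\rangle$ is the free associative algebra on indeterminates $x_{i,g},x_{i,g}^\ast$ ($i\in\mathbb{N},g\in G$); a polynomial is a $(G,\ast)$-identity for $A$ if it vanishes whenever each $x_{i,g}$ is replaced by an element $a_{i,g}\in A_g$ and $x_{i,g}^\ast$ by the image of $a_{i,g}$ under the involution of $A$; $T_{G,\ast}(A)$ is the set of these. $P_n^{G,\ast}$ is the span of the monomials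 $x_{\sigma(1),g_1}^{\delta_1}\cdots x_{\sigma(n),g_n}^{\delta_n}$, $\sigma\in S_n$, $g_i\in G$, $\delta_i\in\{\emptyset,\ast\}$ (here $x^{\emptyset}=x$). Then $c_n^{G,\ast}(A)=\dim P_n^{G,\ast}/(P_n^{G,\ast}\cap T_{G,\ast}(A))$ and $\mathrm{exp}^{G,\ast}(A)=\lim_{n\to\infty}\sqrt[n]{c_n^{G,\ast}(A)}$ when the limit exists. $a_n\sim b_n$ means $a_n/b_n\to1$. *)

theory Defs
  imports
    Complex_Main
    "HOL-Library.Poly_Mapping"
    "HOL-Library.Landau_Symbols"
    "HOL-Combinatorics.Permutations"
    "HOL-Algebra.AbelCoset"
    "HOL-Algebra.Module"
    "Jordan_Normal_Form.VS_Connect"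
begin

text \<open>Algebras over a field \<open>'k\<close> are \<^typ>\<open>('k, 'v) module\<close> records; their scalars are
  \<open>class_ring :: 'k ring\<close>.\<close>

section \<open>Quotient spaces\<close>

text \<open>The vector space of cosets of \<open>W\<close> in \<open>V\<close>. The record type also demands a multiplication and a
  unit, which a vector space does not have.\<close>

definition quotient_space :: "('k, 'v, 'm) module_scheme \<Rightarrow> 'v set \<Rightarrow> ('k, 'v set) module" where
  "quotient_space V W =
     \<lparr>carrier = a_rcosets\<^bsub>V\<^esub> W, mult = undefined, one = undefined, zero = W, add = set_add V,
      smult = (\<lambda>c X. \<Union>x\<in>X. W +>\<^bsub>V\<^esub> (c \<odot>\<^bsub>V\<^esub> x))\<rparr>"

section \<open>The free algebra on graded indeterminates with involution\<close>

text \<open>\<open>Indet i g False\<close> is $x_{i,g}$ and \<open>Indet i g True\<close> is $x_{i,g}^*$.\<close>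

datatype 'g indet = Indet (index: nat) (degree: 'g) (starred: bool)

text \<open>Polynomials are finitely supported functions on words; multiplication extends concatenation
  of words bilinearly.\<close>

definition free_alg :: "'g set \<Rightarrow> ('k::field, 'g indet list \<Rightarrow>\<^sub>0 'k) module" where
  "free_alg G =
     \<lparr>carrier = {p. Poly_Mapping.keys p \<subseteq> lists {x. degree x \<in> G}},
      mult = (\<lambda>p q. \<Sum>u\<in>Poly_Mapping.keys p. \<Sum>v\<in>Poly_Mapping.keys q.
                Poly_Mapping.single (u @ v) (Poly_Mapping.lookup p u * Poly_Mapping.lookup q v)),
      one = Poly_Mapping.single [] 1,
      zero = 0,
      add = (+),
      smult = (\<lambda>c. Poly_Mapping.map ((*) c))\<rparr>"

section \<open>Graded identities with involution and their codimensions\<close>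

text \<open>Substitution of \<open>a i g\<close> for $x_{i,g}$ and of its image under \<open>star\<close> for $x_{i,g}^*$.\<close>

fun indet_val :: "('v \<Rightarrow> 'v) \<Rightarrow> (nat \<Rightarrow> 'g \<Rightarrow> 'v) \<Rightarrow> 'g indet \<Rightarrow> 'v" where
  "indet_val star a (Indet i g s) = (if s then star (a i g) else a i g)"

definition word_val ::
  "('k, 'v) module \<Rightarrow> ('v \<Rightarrow> 'v) \<Rightarrow> (nat \<Rightarrow> 'g \<Rightarrow> 'v) \<Rightarrow> 'g indet list \<Rightarrow> 'v" where
  "word_val A star a w = foldr (\<lambda>x v. indet_val star a x \<otimes>\<^bsub>A\<^esub> v) w \<one>\<^bsub>A\<^esub>"

definition poly_val ::
  "('k::field, 'v) module \<Rightarrow> ('v \<Rightarrow> 'v) \<Rightarrow> (nat \<Rightarrow> 'g \<Rightarrow> 'v) \<Rightarrow> ('g indet list \<Rightarrow>\<^sub>0 'k) \<Rightarrow> 'v" where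
  "poly_val A star a p =
     (\<Oplus>\<^bsub>A\<^esub>w\<in>Poly_Mapping.keys p. Poly_Mapping.lookup p w \<odot>\<^bsub>A\<^esub> word_val A star a w)"

text \<open>In the following, \<open>A\<close> is an algebra graded by \<open>G\<close> with homogeneous components \<open>Ag g\<close>, and
  \<open>star\<close> is an involution of \<open>A\<close> that preserves each of them.\<close>

definition graded_star_identities ::
  "'g set \<Rightarrow> ('k::field, 'v) module \<Rightarrow> ('g \<Rightarrow> 'v set) \<Rightarrow> ('v \<Rightarrow> 'v) \<Rightarrow> ('g indet list \<Rightarrow>\<^sub>0 'k) set" where
  "graded_star_identities G A Ag star =
     {p \<in> carrier (free_alg G).
        \<forall>a. (\<forall>i. \<forall>g\<in>G. a i g \<in> Ag g) \<longrightarrow> poly_val A star a p = \<zero>\<^bsub>A\<^esub>}"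

definition multilinear_monomials :: "'g set \<Rightarrow> nat \<Rightarrow> ('g indet list \<Rightarrow>\<^sub>0 'k::field) set" where
  "multilinear_monomials G n =
     {Poly_Mapping.single (map (\<lambda>k. Indet (\<sigma> k) (g k) (\<delta> k)) [1..<Suc n]) 1 | \<sigma> g \<delta>.
        \<sigma> permutes {1..n} \<and> (\<forall>k\<in>{1..n}. g k \<in> G)}"

definition multilinear_polys :: "'g set \<Rightarrow> nat \<Rightarrow> ('g indet list \<Rightarrow>\<^sub>0 'k::field) set" where
  "multilinear_polys G n =
     LinearCombinations.module.span class_ring (free_alg G) (multilinear_monomials G n)"

definition graded_star_codim ::
  "'g set \<Rightarrow> ('k::field, 'v) module \<Rightarrow> ('g \<Rightarrow> 'v set) \<Rightarrow> ('v \<Rightarrow> 'v) \<Rightarrow> nat \<Rightarrow> nat" where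
  "graded_star_codim G A Ag star n =
     vectorspace.dim (class_ring :: 'k ring)
       (quotient_space (free_alg G \<lparr>carrier := multilinear_polys G n\<rparr>)
          (multilinear_polys G n \<inter> graded_star_identities G A Ag star))"

text \<open>\<open>lim\<close> is meaningful only when the sequence converges.\<close>

definition graded_star_exp ::
  "'g set \<Rightarrow> ('k::field, 'v) module \<Rightarrow> ('g \<Rightarrow> 'v set) \<Rightarrow> ('v \<Rightarrow> 'v) \<Rightarrow> real" where
  "graded_star_exp G A Ag star = lim (\<lambda>n. root n (real (graded_star_codim G A Ag star n)))"

section \<open>Upper triangular matrices\<close>

text \<open>Rows and columns are numbered from \<open>0\<close>, as are the coordinates of vectors.\<close>

definition ut_alg :: "nat \<Rightarrow> ('k::field, 'k mat) module" where
  "ut_alg m = module_mat TYPE('k) m m \<lparr>carrier := {M \<in> carrier_mat m m. upper_triangular M}\<rparr>"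

definition elem_mat :: "nat \<Rightarrow> nat \<Rightarrow> nat \<Rightarrow> 'k::field mat" where
  "elem_mat m i j = mat m m (\<lambda>(k, l). if k = i \<and> l = j then 1 else 0)"

text \<open>The sequence $(e_1,\dots,e_r,0,e_r-e_{r-1},\dots,e_r-e_1)$; the entry $0$ is $e_r-e_r$.\<close>

definition finest_seq :: "nat \<Rightarrow> nat \<Rightarrow> int vec" where
  "finest_seq r i =
     (if i < r then unit_vec r i else unit_vec r (r - 1) - unit_vec r (2 * r - 1 - i))"

definition finest_component :: "nat \<Rightarrow> int vec \<Rightarrow> 'k::field mat set" where
  "finest_component r g = LinearCombinations.module.span class_ring (ut_alg (2 * r))
     {elem_mat (2 * r) i j | i j. i \<le> j \<and> j < 2 * r \<and> finest_seq r i - finest_seq r j = g}"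

definition reflection :: "nat \<Rightarrow> 'k::field mat \<Rightarrow> 'k mat" where
  "reflection m M = mat m m (\<lambda>(i, j). M $$ (m - 1 - j, m - 1 - i))"

lemma reflection_elem_mat:
  assumes "i < m" "j < m"
  shows "reflection m (elem_mat m i j) = elem_mat m (m - 1 - j) (m - 1 - i)"
  using assms by (intro eq_matI) (auto simp: reflection_def elem_mat_def)

definition symplectic_diag :: "nat \<Rightarrow> 'k::field mat" where
  "symplectic_diag r = mat_diag (2 * r) (\<lambda>i. if i < r then 1 else - 1)"

lemma symplectic_diag_self_inverse:
  "symplectic_diag r * symplectic_diag r = (1\<^sub>m (2 * r) :: 'k::field mat)"
  unfolding symplectic_diag_def mat_diag_diag by (intro eq_matI) (auto simp: mat_diag_def)

text \<open>The diagonal matrix is its own inverse, by the preceding lemma.\<close>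

definition symplectic_inv :: "nat \<Rightarrow> 'k::field mat \<Rightarrow> 'k mat" where
  "symplectic_inv r M = symplectic_diag r * reflection (2 * r) M * symplectic_diag r"

end

theory Submission
  imports Defs "HOL-Library.FuncSet" "HOL-Real_Asymp.Real_Asymp"
begin

text \<open>By multilinearity, a multilinear polynomial is an identity if and only if it vanishes when each
  variable $x_{i,g}$ is replaced by a matrix unit $E_{b(i)}$ of degree $g$, or by $0$ when $E_{b(i)}$ has
  another degree. So the codimension is the rank of finitely many linear functionals, namely the matrix
  entries of these values, indexed by the maps \<open>b\<close> and by the entries.

  The value of a monomial is nonzero only if its letters form a path in $1 \le 2 \le \dots \le 2r$, so
  at most $2r - 1$ of the units $E_{b(i)}$ are off the diagonal. The maps with fewer off-diagonal units
  number $O(n^{2r-2} (2r)^n)$ and are negligible. If there are exactly $2r - 1$, then the path takes every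
  step $(k, k+1)$ once. The involution exchanges the steps $(k, k+1)$ and $(2r - k, 2r + 1 - k)$, hence
  \<open>b\<close> takes values twice in each of the $r - 1$ pairs of exchanged steps and once in the central step.
  A monomial determines the map of this kind under which it does not vanish, and each such map
  occurs, so their functionals are linearly independent. There are
  \[ \frac{n!}{2^{r-1} (n - 2r + 1)!} \, 4^{r-1} (2r)^{n-2r+1} \]
  of these maps, which is the leading term.\<close>

section \<open>The dimension of a quotient by a common kernel\<close>

text \<open>For n >= 1 the space of multilinear polynomials is infinite-dimensional, because the
  degrees range over all of Z^r. Hence no basis of it is handled. All that is used is that finitely
  many functionals cut out the identities: their number bounds the codimension from above, and a
  subfamily that is diagonal on chosen monomials bounds it from below. For substitutions with fewer
  than 2r - 1 off-diagonal units, independence is not examined.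

  A monomial recognises its map because degree 0 occurs only on the diagonal. The degrees of its
  letters thus mark the places of the steps, and a path through all steps takes them in increasing
  order.

  The factor 4 for each pair of exchanged steps arises because each of the two indices of the pair
  may carry either step, even both the same one: stars on the letters restore a path that takes each
  step once.\<close>

lemma quotient_space_simps [simp]:
  "carrier (quotient_space V W) = a_rcosets\<^bsub>V\<^esub> W"
  "zero (quotient_space V W) = W"
  "add (quotient_space V W) = set_add V"
  by (simp_all add: quotient_space_def)

section \<open>The quotient of a vector space by a subspace\<close>

locale quotient_by_subspace = vectorspace K V for K (structure) and V (structure) +
  fixes W
  assumes W: "submodule K W V"
begin

interpretation W: submodule K W V by (rule W)

lemma neg_closed_W:
  assumes "x \<in> W" shows "\<ominus>\<^bsub>V\<^esub> x \<in> W"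
proof -
  have "\<ominus>\<^bsub>K\<^esub> \<one>\<^bsub>K\<^esub> \<odot>\<^bsub>V\<^esub> x \<in> W" using assms by (intro W.smult_closed) auto
  then show ?thesis using smult_minus_1[of x] W.subset assms by (metis subsetD)
qed

lemma abelian_subgroup_W: "abelian_subgroup W V"
proof -
  have "subgroup W (add_monoid V)"
    using W.subset neg_closed_W by unfold_locales (auto simp: a_inv_def)
  then show ?thesis
    by (intro abelian_subgroupI3 additive_subgroup.intro) (auto intro: M.abelian_group_axioms)
qed

interpretation abelian_subgroup W V by (rule abelian_subgroup_W)

abbreviation proj where "proj v \<equiv> W +>\<^bsub>V\<^esub> v"
abbreviation Q where "Q \<equiv> quotient_space V W"

lemma proj_eqI:
  assumes "h \<in> W" "v \<in> carrier V"
  shows "proj (h \<oplus>\<^bsub>V\<^esub> v) = proj v"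
  using assms by (intro a_repr_independence'[symmetric]) (auto simp: a_r_coset_def')

lemma proj_eqD:
  assumes "proj v = proj w" "v \<in> carrier V" "w \<in> carrier V"
  obtains h where "h \<in> W" "v = h \<oplus>\<^bsub>V\<^esub> w"
proof -
  have "v \<in> proj w" using a_rcos_self[OF assms(2)] assms(1) by simp
  then show ?thesis using that by (auto simp: a_r_coset_def')
qed

lemma carrier_Q: "carrier Q = proj ` carrier V"
  by (auto simp: A_RCOSETS_def')

lemma proj_add: "\<lbrakk>v \<in> carrier V; w \<in> carrier V\<rbrakk> \<Longrightarrow> proj v \<oplus>\<^bsub>Q\<^esub> proj w = proj (v \<oplus>\<^bsub>V\<^esub> w)"
  by (simp add: a_rcos_sum)

text \<open>The scalar multiple of a coset is a union of cosets, one for each representative. All of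
  them coincide, and the coset is not empty, so the union is a single coset.\<close>

lemma proj_smult:
  assumes "c \<in> carrier K" "v \<in> carrier V"
  shows "c \<odot>\<^bsub>Q\<^esub> proj v = proj (c \<odot>\<^bsub>V\<^esub> v)"
proof -
  have "W +>\<^bsub>V\<^esub> (c \<odot>\<^bsub>V\<^esub> x) = proj (c \<odot>\<^bsub>V\<^esub> v)" if x: "x \<in> proj v" for x
  proof -
    obtain h where h: "h \<in> W" "x = h \<oplus>\<^bsub>V\<^esub> v" using x by (auto simp: a_r_coset_def')
    have "c \<odot>\<^bsub>V\<^esub> x = c \<odot>\<^bsub>V\<^esub> h \<oplus>\<^bsub>V\<^esub> c \<odot>\<^bsub>V\<^esub> v"
      unfolding h(2) by (rule smult_r_distr[OF assms(1) subsetD[OF W.subset h(1)] assms(2)])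
    then show ?thesis using proj_eqI[OF W.smult_closed[OF assms(1) h(1)] smult_closed[OF assms]] by simp
  qed
  moreover have "proj v \<noteq> {}" using a_rcos_self[OF assms(2)] by blast
  ultimately have "(\<Union>x\<in>proj v. proj (c \<odot>\<^bsub>V\<^esub> x)) = proj (c \<odot>\<^bsub>V\<^esub> v)"
    by (intro SUP_eq_const)
  then show ?thesis by (simp add: quotient_space_def)
qed

lemma proj_zero: "proj \<zero>\<^bsub>V\<^esub> = W"
  by (rule a_coset_add_zero[OF W.subset])

lemma proj_W: "w \<in> W \<Longrightarrow> proj w = \<zero>\<^bsub>Q\<^esub>"
  using proj_eqI[of w "\<zero>\<^bsub>V\<^esub>"] subsetD[OF W.subset, of w] by (simp add: proj_zero)

lemma vectorspace_Q: "vectorspace K Q"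
proof (rule vs_criteria)
  show "\<zero>\<^bsub>Q\<^esub> \<in> carrier Q" unfolding carrier_Q using proj_zero M.zero_closed by (metis imageI quotient_space_simps(2))
  have "\<exists>n\<in>carrier V. proj (v \<oplus>\<^bsub>V\<^esub> n) = \<zero>\<^bsub>Q\<^esub>" if "v \<in> carrier V" for v
    using that proj_zero by (intro bexI[of _ "\<ominus>\<^bsub>V\<^esub> v"]) (auto simp: r_neg M.r_neg)
  then show "\<forall>v\<in>carrier Q. \<exists>n\<in>carrier Q. v \<oplus>\<^bsub>Q\<^esub> n = \<zero>\<^bsub>Q\<^esub>"
    unfolding carrier_Q by (auto simp del: quotient_space_simps simp: proj_add) 
  have "proj v \<oplus>\<^bsub>Q\<^esub> \<zero>\<^bsub>Q\<^esub> = proj v" if "v \<in> carrier V" for v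
    using that proj_add[of v "\<zero>\<^bsub>V\<^esub>"] proj_zero by auto
  then show "\<forall>v\<in>carrier Q. v \<oplus>\<^bsub>Q\<^esub> \<zero>\<^bsub>Q\<^esub> = v" unfolding carrier_Q by blast
qed (unfold carrier_Q, auto simp del: quotient_space_simps simp: proj_add proj_smult M.a_ac
      smult_l_distr smult_r_distr smult_assoc1 intro: field_axioms field.field_axioms)

end

text \<open>Scalars live in the ring record \<open>R\<close>, values in a type of class
  \<open>comm_ring\<close>; the map \<open>\<phi>\<close> translates between the two. Over
  \<open>class_ring\<close> it becomes the identity.\<close>

lemma (in module) linear_functional_lincomb:
  assumes add: "\<And>v w. v \<in> carrier M \<Longrightarrow> w \<in> carrier M \<Longrightarrow> g (v \<oplus>\<^bsub>M\<^esub> w) = g v + (g w :: 'z::comm_ring)"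
    and smult: "\<And>c v. c \<in> carrier R \<Longrightarrow> v \<in> carrier M \<Longrightarrow> g (c \<odot>\<^bsub>M\<^esub> v) = \<phi> c * g v"
    and A: "finite A" "A \<subseteq> carrier M" "a \<in> A \<rightarrow> carrier R"
  shows "g (lincomb a A) = (\<Sum>v\<in>A. \<phi> (a v) * g v)"
  using A
proof (induction A rule: finite_induct)
  case empty
  have "g \<zero>\<^bsub>M\<^esub> = g \<zero>\<^bsub>M\<^esub> + g \<zero>\<^bsub>M\<^esub>" using add[of "\<zero>\<^bsub>M\<^esub>" "\<zero>\<^bsub>M\<^esub>"] by simp
  then show ?case by (simp add: lincomb_def)
next
  case (insert x F)
  have "lincomb a (F \<union> {x}) = (a x \<odot>\<^bsub>M\<^esub> x) \<oplus>\<^bsub>M\<^esub> lincomb a F"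
    by (rule lincomb_insert) (use insert in auto)
  moreover have "lincomb a F \<in> carrier M" using insert by (intro lincomb_closed) auto
  moreover have "a x \<odot>\<^bsub>M\<^esub> x \<in> carrier M" using insert by (intro smult_closed) auto
  ultimately have "g (lincomb a (insert x F)) = \<phi> (a x) * g x + g (lincomb a F)"
    using insert by (simp add: add smult Pi_iff)
  then show ?case using insert by simp
qed

section \<open>The common kernel of finitely many linear functionals\<close>

locale common_kernel = vectorspace "class_ring :: 'k::field ring" V for V :: "('k::field, 'v, 'm) module_scheme" (structure) +
  fixes I :: "'i set" and f :: "'i \<Rightarrow> 'v \<Rightarrow> 'k::field" and W :: "'v set"
  assumes fin_I: "finite I"
    and f_add: "\<And>i v w. i \<in> I \<Longrightarrow> v \<in> carrier V \<Longrightarrow> w \<in> carrier V \<Longrightarrow> f i (v \<oplus>\<^bsub>V\<^esub> w) = f i v + f i w"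
    and f_smult: "\<And>i c v. i \<in> I \<Longrightarrow> v \<in> carrier V \<Longrightarrow> f i (c \<odot>\<^bsub>V\<^esub> v) = c * f i v"
    and W_def: "W = {v \<in> carrier V. \<forall>i\<in>I. f i v = 0}"
begin

lemma f_zero:
  assumes "i \<in> I" shows "f i \<zero>\<^bsub>V\<^esub> = 0"
proof -
  have "0 \<odot>\<^bsub>V\<^esub> \<zero>\<^bsub>V\<^esub> = \<zero>\<^bsub>V\<^esub>" by (rule smult_r_null) simp
  then show ?thesis using f_smult[OF assms M.zero_closed, of 0] by simp
qed

lemma submodule_W: "submodule class_ring W V"
proof (rule submodule.intro)
  show "module class_ring V" by (rule module_axioms)
  show "W \<subseteq> carrier V" by (auto simp: W_def)
  show "\<zero>\<^bsub>V\<^esub> \<in> W" by (simp add: W_def f_zero)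
  show "v \<oplus>\<^bsub>V\<^esub> w \<in> W" if "v \<in> W" "w \<in> W" for v w
    using that by (simp add: W_def f_add)
  show "c \<odot>\<^bsub>V\<^esub> v \<in> W" if "v \<in> W" for c v
    using that smult_closed[of c v] by (simp add: W_def f_smult)
qed

sublocale quotient_by_subspace "class_ring :: 'k ring" V W
  by (intro quotient_by_subspace.intro quotient_by_subspace_axioms.intro vectorspace_axioms submodule_W)

text \<open>\<open>V\<close> may be infinite-dimensional, so dimensions of \<open>V\<close> and
  \<open>W\<close> cannot be subtracted. Instead, one generator is added for each functional that
  does not yet vanish on the common kernel of the previous ones: modulo this vector, every element
  of the old kernel lies in the new one. Generation modulo \<open>W\<close> is expressed by saying
  that no proper subspace contains \<open>S\<close> and \<open>W\<close>, which avoids linear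
  combinations.\<close>

lemma ex_generators_modulo_kernel:
  "\<exists>S. finite S \<and> S \<subseteq> carrier V \<and> card S \<le> card I \<and>
     (\<forall>U. submodule class_ring U V \<and> S \<subseteq> U \<and> W \<subseteq> U \<longrightarrow> U = carrier V)"
proof -
  have "\<exists>S. finite S \<and> S \<subseteq> carrier V \<and> card S \<le> card J \<and>
     (\<forall>U. submodule class_ring U V \<and> S \<subseteq> U \<and> {v \<in> carrier V. \<forall>i\<in>J. f i v = 0} \<subseteq> U \<longrightarrow> U = carrier V)"
    if "J \<subseteq> I" for J
    using finite_subset[OF that fin_I] that
  proof (induction J rule: finite_induct)
    case empty
    then show ?case by (intro exI[of _ "{}"]) (auto simp: submodule_def)
  next
    case (insert i J)
    let ?WJ = "{v \<in> carrier V. \<forall>i\<in>J. f i v = 0}" and ?W' = "{v \<in> carrier V. \<forall>j\<in>insert i J. f j v = 0}"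
    obtain S where S: "finite S" "S \<subseteq> carrier V" "card S \<le> card J"
      "\<And>U. submodule class_ring U V \<Longrightarrow> S \<subseteq> U \<Longrightarrow> ?WJ \<subseteq> U \<Longrightarrow> U = carrier V"
      using insert by auto
    show ?case
    proof (cases "\<forall>w\<in>?WJ. f i w = 0")
      case True
      then have "?W' = ?WJ" by auto
      then show ?thesis using S insert.hyps by (intro exI[of _ S]) simp
    next
      case False
      then obtain w where w: "w \<in> ?WJ" "f i w \<noteq> 0" by auto
      have "U = carrier V" if U: "submodule class_ring U V" "Set.insert w S \<subseteq> U" "?W' \<subseteq> U" for U
      proof (rule S(4)[OF U(1)])
        show "S \<subseteq> U" using U by auto
        show "?WJ \<subseteq> U"
        proof
          fix v assume v: "v \<in> ?WJ"
          interpret U: submodule class_ring U V by (rule U)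
          \<comment> \<open>With this scalar, subtracting \<open>c\<close> times \<open>w\<close>
            from \<open>v\<close> makes \<open>f i\<close> vanish. The functionals in
            \<open>J\<close> still vanish, because \<open>w\<close> lies in their kernel.\<close>
          define c where "c = f i v / f i w"
          have vw: "v \<in> carrier V" "w \<in> carrier V" "w \<in> U" using v w U by auto
          have cw: "c' \<odot>\<^bsub>V\<^esub> w \<in> carrier V" for c' using vw by (intro smult_closed) auto
          have "v \<oplus>\<^bsub>V\<^esub> (- c) \<odot>\<^bsub>V\<^esub> w \<in> ?W'"
            using v w insert.prems cw by (auto simp: f_add f_smult subset_iff c_def)
          then have "v \<oplus>\<^bsub>V\<^esub> (- c) \<odot>\<^bsub>V\<^esub> w \<in> U" using U(3) by blast
          moreover have "c \<odot>\<^bsub>V\<^esub> w \<in> U" using U.smult_closed[of c w] vw by simp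
          ultimately have "(v \<oplus>\<^bsub>V\<^esub> (- c) \<odot>\<^bsub>V\<^esub> w) \<oplus>\<^bsub>V\<^esub> c \<odot>\<^bsub>V\<^esub> w \<in> U" by (rule U.m_closed)
          also have "(v \<oplus>\<^bsub>V\<^esub> (- c) \<odot>\<^bsub>V\<^esub> w) \<oplus>\<^bsub>V\<^esub> c \<odot>\<^bsub>V\<^esub> w = v \<oplus>\<^bsub>V\<^esub> ((- c) \<odot>\<^bsub>V\<^esub> w \<oplus>\<^bsub>V\<^esub> c \<odot>\<^bsub>V\<^esub> w)"
            by (rule M.a_assoc[OF vw(1) cw cw])
          also have "(- c) \<odot>\<^bsub>V\<^esub> w \<oplus>\<^bsub>V\<^esub> c \<odot>\<^bsub>V\<^esub> w = \<zero>\<^bsub>V\<^esub>"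
            using smult_l_distr[of "- c" c w] smult_l_null[of w] vw by simp
          finally show "v \<in> U" using vw by simp
        qed
      qed
      moreover have "card (Set.insert w S) \<le> card (Set.insert i J)"
        using S insert.hyps by (simp add: card_insert_if)
      ultimately show ?thesis using S(1,2) w(1)
        by (intro exI[of _ "Set.insert w S"]) simp
    qed
  qed
  from this[OF subset_refl] show ?thesis unfolding W_def .
qed

text \<open>The vectors whose cosets lie in the span of the projected generators form a subspace. It
  contains \<open>S\<close> and \<open>W\<close>, hence is all of \<open>V\<close>.\<close>

lemma ex_generators_Q:
  "\<exists>T. finite T \<and> T \<subseteq> carrier Q \<and> card T \<le> card I \<and> LinearCombinations.module.span class_ring Q T = carrier Q"
proof -
  interpret Q: vectorspace "class_ring :: 'k ring" Q by (rule vectorspace_Q)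
  obtain S where S: "finite S" "S \<subseteq> carrier V" "card S \<le> card I"
    "\<And>U. submodule class_ring U V \<Longrightarrow> S \<subseteq> U \<Longrightarrow> W \<subseteq> U \<Longrightarrow> U = carrier V"
  proof -
    from ex_generators_modulo_kernel obtain S where
      "finite S \<and> S \<subseteq> carrier V \<and> card S \<le> card I \<and>
        (\<forall>U. submodule class_ring U V \<and> S \<subseteq> U \<and> W \<subseteq> U \<longrightarrow> U = carrier V)" ..
    then show ?thesis by (intro that[of S]) simp_all
  qed
  have sub: "proj ` S \<subseteq> carrier Q" using S unfolding carrier_Q by auto
  interpret T: submodule "class_ring :: 'k ring" "Q.span (proj ` S)" Q
    by (rule Q.span_is_submodule[OF sub])
  let ?U = "{v \<in> carrier V. proj v \<in> Q.span (proj ` S)}"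
  have "?U = carrier V"
  proof (rule S(4))
    show "submodule class_ring ?U V"
      using T.m_closed T.smult_closed T.zero_closed[unfolded quotient_space_simps] submodule.subset[OF W]
      by (intro submodule.intro)
        (auto simp del: quotient_space_simps simp flip: proj_add proj_smult intro: module_axioms smult_closed)
    show "S \<subseteq> ?U" using S Q.in_own_span[OF sub] by auto
    show "W \<subseteq> ?U" using proj_W Q.span_zero submodule.subset[OF W] by auto
  qed
  then have "carrier Q \<subseteq> Q.span (proj ` S)" unfolding carrier_Q by auto
  then have "Q.span (proj ` S) = carrier Q" using T.subset by auto
  then show ?thesis using S sub card_image_le[OF S(1), of proj] by (intro exI[of _ "proj ` S"]) auto
qed

lemma dim_quotient_le: "VectorSpace.vectorspace.dim class_ring (quotient_space V W) \<le> card I"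
proof -
  interpret Q: vectorspace "class_ring :: 'k ring" Q by (rule vectorspace_Q)
  show ?thesis using ex_generators_Q Q.gen_ge_dim by (meson le_trans)
qed

text \<open>Functionals in \<open>J\<close> that are diagonal on the vectors \<open>v j\<close>
  force the cosets of these vectors to be independent: applying the i-th one to a vanishing
  combination isolates the i-th coefficient.\<close>

lemma dim_quotient_ge:
  assumes J: "J \<subseteq> I" and v: "\<And>j. j \<in> J \<Longrightarrow> v j \<in> carrier V"
    and diag: "\<And>j. j \<in> J \<Longrightarrow> f j (v j) \<noteq> 0"
    and off: "\<And>i j. i \<in> J \<Longrightarrow> j \<in> J \<Longrightarrow> i \<noteq> j \<Longrightarrow> f i (v j) = 0"
  shows "card J \<le> VectorSpace.vectorspace.dim class_ring (quotient_space V W)"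
proof -
  interpret Q: vectorspace "class_ring :: 'k ring" Q by (rule vectorspace_Q)
  \<comment> \<open>The functional induced on the quotient. Any representative will do, since
    \<open>f i\<close> vanishes on \<open>W\<close>.\<close>
  define g where "g i X = f i (SOME x. x \<in> carrier V \<and> X = proj x)" for i X
  have g: "g i (proj x) = f i x" if ix: "i \<in> I" "x \<in> carrier V" for i x
  proof -
    define y where "y = (SOME y. y \<in> carrier V \<and> proj x = proj y)"
    have y: "y \<in> carrier V \<and> proj x = proj y" unfolding y_def
      using someI[where P = "\<lambda>y. y \<in> carrier V \<and> proj x = proj y", OF conjI[OF that(2) refl]] .
    obtain h where "h \<in> W" "x = h \<oplus>\<^bsub>V\<^esub> y"
      using proj_eqD[OF conjunct2[OF y] ix(2) conjunct1[OF y]] by blast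
    then have "f i x = f i y" using f_add[OF ix(1), of h y] ix y by (simp add: W_def)
    then show ?thesis by (simp add: g_def y_def)
  qed
  have fin_J: "finite J" using J fin_I finite_subset by blast
  have inj: "inj_on (\<lambda>j. proj (v j)) J"
  proof (rule inj_onI, rule ccontr)
    fix i j assume ij: "i \<in> J" "j \<in> J" "proj (v i) = proj (v j)" "i \<noteq> j"
    then have "f i (v i) = f i (v j)" using g[of i "v i"] g[of i "v j"] J v by auto
    then show False using diag off ij by auto
  qed
  have "Q.lin_indpt ((\<lambda>j. proj (v j)) ` J)"
  proof (rule Q.finite_lin_indpt2)
    show sub: "(\<lambda>j. proj (v j)) ` J \<subseteq> carrier Q" unfolding carrier_Q using v by auto
    fix a :: "'v set \<Rightarrow> 'k" assume a: "Q.lincomb a ((\<lambda>j. proj (v j)) ` J) = \<zero>\<^bsub>Q\<^esub>"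
    have "a (proj (v i)) = 0" if i: "i \<in> J" for i
    proof -
      have iI: "i \<in> I" using i J by auto
      have "g i (Q.lincomb a ((\<lambda>j. proj (v j)) ` J)) = (\<Sum>X\<in>(\<lambda>j. proj (v j)) ` J. a X * g i X)"
        by (rule Q.linear_functional_lincomb[where \<phi> = "\<lambda>x. x"])
          (use iI fin_J sub in \<open>auto simp del: quotient_space_simps simp: carrier_Q proj_add proj_smult g f_add f_smult smult_closed\<close>)
      also have "\<dots> = (\<Sum>j\<in>J. a (proj (v j)) * f i (v j))"
        using iI v by (subst sum.reindex[OF inj]) (auto simp: g intro!: sum.cong)
      also have "\<dots> = a (proj (v i)) * f i (v i)"
        using fin_J i by (subst sum.remove[of _ i]) (use off[OF i] in \<open>force intro!: sum.neutral\<close>)+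
      finally have "g i \<zero>\<^bsub>Q\<^esub> = a (proj (v i)) * f i (v i)" unfolding a .
      moreover have "g i \<zero>\<^bsub>Q\<^esub> = 0"
        using g[of i "\<zero>\<^bsub>V\<^esub>"] iI f_zero[OF iI] submodule.subset[OF W] by simp
      ultimately show ?thesis using diag[OF i] by simp
    qed
    then show "\<forall>X\<in>(\<lambda>j. proj (v j)) ` J. a X = \<zero>\<^bsub>class_ring\<^esub>" by auto
  qed (use fin_J in auto)
  moreover have "(\<lambda>j. proj (v j)) ` J \<subseteq> carrier Q" unfolding carrier_Q using v by auto
  \<comment> \<open>Comparing an independent set with \<open>dim\<close> requires a finite
    generating set. The quotient has one even when \<open>V\<close> has none.\<close>
  moreover have "Q.fin_dim" unfolding Q.fin_dim_def using ex_generators_Q by blast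
  ultimately have "card ((\<lambda>j. proj (v j)) ` J) \<le> Q.dim" by (intro Q.li_le_dim) auto
  then show ?thesis by (simp add: card_image[OF inj])
qed

end

section \<open>Counting colourings\<close>

text \<open>Colours in \<open>D\<close> are unrestricted, while each class \<open>C j\<close> has a
  prescribed total number of uses. Whole classes are counted rather than colours, because the
  involution makes the members of a class interchangeable.\<close>

definition colourings ::
  "'a set \<Rightarrow> 'c set \<Rightarrow> (nat \<Rightarrow> 'c set) \<Rightarrow> (nat \<Rightarrow> nat) \<Rightarrow> nat \<Rightarrow> ('a \<Rightarrow> 'c) set" where
  "colourings A D C m k =
     {b \<in> A \<rightarrow>\<^sub>E D \<union> (\<Union>j<k. C j). \<forall>j<k. card {a \<in> A. b a \<in> C j} = m j}"

text \<open>A multinomial count in recursive form, so that asymptotics follow by the same recursion.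
  The truncated subtraction is harmless: the binomial vanishes when \<open>m k\<close> exceeds
  n.\<close>

fun num_colourings :: "nat \<Rightarrow> (nat \<Rightarrow> nat) \<Rightarrow> (nat \<Rightarrow> nat) \<Rightarrow> nat \<Rightarrow> nat \<Rightarrow> nat" where
  "num_colourings d c m 0 n = d ^ n"
| "num_colourings d c m (Suc k) n = (n choose m k) * c k ^ m k * num_colourings d c m k (n - m k)"

text \<open>Choose the set of places coloured from the last class, colour it freely within that
  class, and colour the remaining places by the earlier classes and \<open>D\<close>.\<close>

lemma card_colourings:
  assumes "finite A" "finite D" "\<And>j. j < k \<Longrightarrow> finite (C j)"
    and "\<And>j. j < k \<Longrightarrow> D \<inter> C j = {}" "\<And>i j. i < j \<Longrightarrow> j < k \<Longrightarrow> C i \<inter> C j = {}"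
  shows "finite (colourings A D C m k)"
    and "card (colourings A D C m k) = num_colourings (card D) (\<lambda>j. card (C j)) m k (card A)"
proof -
  have fin: "finite (colourings A D C m k)" if "finite A" for A :: "'a set"
    using assms(2,3) that by (intro finite_subset[OF _ finite_PiE[OF that, of "\<lambda>_. D \<union> (\<Union>j<k. C j)"]])
      (auto simp: colourings_def)
  then show "finite (colourings A D C m k)" using assms by blast
  show "card (colourings A D C m k) = num_colourings (card D) (\<lambda>j. card (C j)) m k (card A)"
    using assms
  proof (induction k arbitrary: A)
    case 0
    then show ?case by (simp add: colourings_def card_funcsetE)
  next
    case (Suc k)
    let ?S = "{S. S \<subseteq> A \<and> card S = m k}"
    let ?R = "Sigma ?S (\<lambda>S. (S \<rightarrow>\<^sub>E C k) \<times> colourings (A - S) D C m k)"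
    have disj: "D \<inter> C k = {}" "\<And>j. j < k \<Longrightarrow> C j \<inter> C k = {}" using Suc.prems by auto
    \<comment> \<open>By disjointness the chosen set of places can be read off from the combined
      colouring, which makes the splitting reversible.\<close>
    have outside: "x \<notin> C k" if "x \<in> D \<union> (\<Union>j<k. C j)" for x
      using that disj by auto
    define \<phi> where "\<phi> b = (let S = {a \<in> A. b a \<in> C k} in (S, restrict b S, restrict b (A - S)))" for b
    define \<psi> where "\<psi> = (\<lambda>(S, u, v). (\<lambda>a. if a \<in> S then u a else v a) :: 'a \<Rightarrow> 'b)"
    have "bij_betw \<phi> (colourings A D C m (Suc k)) ?R"
    proof (rule bij_betw_byWitness[where f' = \<psi>])
      show "\<forall>b\<in>colourings A D C m (Suc k). \<psi> (\<phi> b) = b"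
        by (auto simp: colourings_def \<phi>_def \<psi>_def Let_def fun_eq_iff PiE_def extensional_def)
      show "\<forall>p\<in>?R. \<phi> (\<psi> p) = p"
      proof (rule ballI)
        fix p assume "p \<in> ?R"
        then obtain S u v where p: "p = (S, u, v)" and *: "S \<subseteq> A" "m k = card S" "u \<in> S \<rightarrow>\<^sub>E C k"
            "v \<in> colourings (A - S) D C m k" by auto
        have v: "v \<in> (A - S) \<rightarrow>\<^sub>E D \<union> (\<Union>j<k. C j)" using * by (auto simp: colourings_def)
        have S: "{a \<in> A. (if a \<in> S then u a else v a) \<in> C k} = S"
          using * PiE_mem[OF *(3)] PiE_mem[OF v] outside by auto
        have "restrict (\<lambda>a. if a \<in> S then u a else v a) S = u"
          using * by (auto simp: fun_eq_iff PiE_def extensional_def)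
        moreover have "restrict (\<lambda>a. if a \<in> S then u a else v a) (A - S) = v"
          using v by (auto simp: fun_eq_iff PiE_def extensional_def)
        ultimately show "\<phi> (\<psi> p) = p" by (simp add: p \<phi>_def \<psi>_def S)
      qed
      show "\<phi> ` colourings A D C m (Suc k) \<subseteq> ?R"
      proof (rule image_subsetI)
        fix b assume b: "b \<in> colourings A D C m (Suc k)"
        let ?T = "{a \<in> A. b a \<in> C k}"
        have 1: "b a \<in> D \<union> (\<Union>j<k. C j)" if "a \<in> A - ?T" for a
        proof -
          have "b \<in> A \<rightarrow>\<^sub>E D \<union> (\<Union>j<Suc k. C j)" using b by (simp add: colourings_def)
          from PiE_mem[OF this, of a] show ?thesis using that by (auto simp: less_Suc_eq)
        qed
        have "card {a \<in> A - ?T. restrict b (A - ?T) a \<in> C j} = m j" if "j < k" for j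
        proof -
          have "{a \<in> A - ?T. restrict b (A - ?T) a \<in> C j} = {a \<in> A. b a \<in> C j}"
            using disj(2)[OF that] by auto
          then show ?thesis using b that by (simp add: colourings_def)
        qed
        then have "restrict b (A - ?T) \<in> colourings (A - ?T) D C m k"
          using 1 by (auto simp: colourings_def)
        moreover have "card ?T = m k" using b by (auto simp: colourings_def)
        ultimately show "\<phi> b \<in> ?R" by (auto simp: \<phi>_def Let_def)
      qed
      show "\<psi> ` ?R \<subseteq> colourings A D C m (Suc k)"
      proof (rule image_subsetI)
        fix p assume "p \<in> ?R"
        then obtain S u v where p: "p = (S, u, v)" and *: "S \<subseteq> A" "m k = card S" "u \<in> S \<rightarrow>\<^sub>E C k"
            "v \<in> colourings (A - S) D C m k" by auto
        let ?b = "\<psi> (S, u, v)"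
        have v: "v \<in> (A - S) \<rightarrow>\<^sub>E D \<union> (\<Union>j<k. C j)" using * by (auto simp: colourings_def)
        have S: "{a \<in> A. ?b a \<in> C k} = S"
          using * PiE_mem[OF *(3)] PiE_mem[OF v] outside by (auto simp: \<psi>_def)
        have "card {a \<in> A. ?b a \<in> C j} = m j" if "j < k" for j
        proof -
          have "{a \<in> A. ?b a \<in> C j} = {a \<in> A - S. v a \<in> C j}"
            using * PiE_mem[OF *(3)] disj(2)[OF that] by (auto simp: \<psi>_def)
          then show ?thesis using * that by (simp add: colourings_def)
        qed
        moreover have "?b \<in> A \<rightarrow>\<^sub>E D \<union> (\<Union>j<Suc k. C j)"
        proof (rule PiE_I)
          fix a assume "a \<in> A"
          then show "?b a \<in> D \<union> (\<Union>j<Suc k. C j)"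
            using PiE_mem[OF *(3), of a] PiE_mem[OF v, of a] by (auto simp: \<psi>_def less_Suc_eq)
        next
          fix a assume "a \<notin> A"
          then show "?b a = undefined" using * v by (auto simp: \<psi>_def PiE_def extensional_def)
        qed
        ultimately show "\<psi> p \<in> colourings A D C m (Suc k)"
          using S *(2) by (auto simp: p colourings_def less_Suc_eq)
      qed
    qed
    then have "card (colourings A D C m (Suc k)) = card ?R" by (rule bij_betw_same_card)
    also have "\<dots> = (\<Sum>S\<in>?S. card ((S \<rightarrow>\<^sub>E C k) \<times> colourings (A - S) D C m k))"
    proof (rule card_SigmaI)
      show "finite ?S" using Suc.prems by simp
      have "finite (colourings B D C m k)" if "finite B" for B :: "'a set"
        using Suc.prems(2,3) that
        by (intro finite_subset[OF _ finite_PiE[OF that, of "\<lambda>_. D \<union> (\<Union>j<k. C j)"]])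
          (auto simp: colourings_def)
      then show "\<forall>S\<in>?S. finite ((S \<rightarrow>\<^sub>E C k) \<times> colourings (A - S) D C m k)"
        using Suc.prems finite_subset[OF _ Suc.prems(1)] by (auto intro!: finite_cartesian_product finite_PiE)
    qed
    also have "\<dots> = (\<Sum>S\<in>?S. card (C k) ^ m k * num_colourings (card D) (\<lambda>j. card (C j)) m k (card A - m k))"
    proof (rule sum.cong[OF refl])
      fix S assume "S \<in> ?S"
      then have S: "S \<subseteq> A" "card S = m k" "finite S" using finite_subset Suc.prems(1) by auto
      have "card (colourings (A - S) D C m k)
          = num_colourings (card D) (\<lambda>j. card (C j)) m k (card (A - S))"
        using Suc.prems by (intro Suc.IH) auto
      then show "card ((S \<rightarrow>\<^sub>E C k) \<times> colourings (A - S) D C m k)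
          = card (C k) ^ m k * num_colourings (card D) (\<lambda>j. card (C j)) m k (card A - m k)"
        using S by (simp add: card_cartesian_product card_funcsetE card_Diff_subset)
    qed
    also have "\<dots> = num_colourings (card D) (\<lambda>j. card (C j)) m (Suc k) (card A)"
      using n_subsets[OF Suc.prems(1)] by simp
    finally show ?case .
  qed
qed

section \<open>Asymptotics of the counts\<close>

text \<open>Passing from m to m + 1 multiplies the binomial by (n - m) / (m + 1). Over the reals
  this holds even for n < m, where both binomials are 0.\<close>

lemma asymp_equiv_binomial:
  "(\<lambda>n. real (n choose m)) \<sim>[sequentially] (\<lambda>n. real n ^ m / fact m)"
proof (induction m)
  case (Suc m)
  have "(\<lambda>n. real (n choose m) * ((real n - real m) / (real m + 1))) \<sim>[sequentially]
        (\<lambda>n. (real n ^ m / fact m) * (real n / (real m + 1)))"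
    by (intro asymp_equiv_mult asymp_equiv_divide Suc.IH) real_asymp+
  also have "(\<lambda>n. real (n choose m) * ((real n - real m) / (real m + 1))) = (\<lambda>n. real (n choose Suc m))"
  proof
    fix n
    have "real (n choose Suc m) * real (Suc m) = real (n choose m) * (real n - real m)"
    proof (cases "m \<le> n")
      case True
      have "Suc m * (n choose Suc m) = (n choose m) * (n - m)"
        by (cases n) (use True binomial_absorb_comp[of n m] Suc_times_binomial_eq binomial_absorption in
          \<open>auto simp: mult.commute binomial_eq_0\<close>)
      then show ?thesis using True by (metis mult.commute of_nat_diff of_nat_mult)
    next
      case False
      then show ?thesis by (cases "m = Suc n") (auto simp: binomial_eq_0)
    qed
    then show "real (n choose m) * ((real n - real m) / (real m + 1)) = real (n choose Suc m)"
      by (simp add: field_simps)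
  qed
  finally show ?case by (simp add: field_simps)
qed simp

lemma asymp_equiv_num_colourings:
  assumes "d > 0"
  shows "(\<lambda>n. real (num_colourings d c m k n)) \<sim>[sequentially]
    (\<lambda>n. (\<Prod>j<k. real (c j) ^ m j / (fact (m j) * real d ^ m j)) * real n ^ (\<Sum>j<k. m j) * real d ^ n)"
proof (induction k)
  case (Suc k)
  let ?P = "\<Prod>j<k. real (c j) ^ m j / (fact (m j) * real d ^ m j)" and ?M = "\<Sum>j<k. m j"
  have lim: "filterlim (\<lambda>n. n - m k) sequentially sequentially"
    by (rule filterlim_minus_const_nat_at_top)
  have "(\<lambda>n. real (n - m k)) \<sim>[sequentially] (\<lambda>n. real n)"
  proof -
    have "eventually (\<lambda>n. real n - real (m k) = real (n - m k)) sequentially"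
      using eventually_ge_at_top[of "m k"] by eventually_elim (simp add: of_nat_diff)
    then have "(\<lambda>n. real n - real (m k)) \<sim>[sequentially] (\<lambda>n. real n) \<longleftrightarrow> ?thesis"
      by (rule asymp_equiv_cong) simp
    moreover have "(\<lambda>n. real n - real (m k)) \<sim>[sequentially] (\<lambda>n. real n)" by real_asymp
    ultimately show ?thesis by simp
  qed
  then have pow: "(\<lambda>n. real (n - m k) ^ ?M) \<sim>[sequentially] (\<lambda>n. real n ^ ?M)"
    by (rule asymp_equiv_power)
  \<comment> \<open>Setting \<open>m k\<close> places aside leaves the leading polynomial term
    unchanged but divides the geometric factor by \<open>d ^ m k\<close>. This is the source of the
    powers of \<open>d\<close> in the product.\<close>
  have "eventually (\<lambda>n. real d ^ n / real d ^ m k = real d ^ (n - m k)) sequentially"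
    using eventually_ge_at_top[of "m k"] by eventually_elim (use assms in \<open>simp add: power_diff\<close>)
  then have geo: "(\<lambda>n. real d ^ (n - m k)) \<sim>[sequentially] (\<lambda>n. real d ^ n / real d ^ m k)"
    by (intro asymp_equiv_refl_ev) (simp add: eq_commute)
  have "(\<lambda>n. real (n choose m k) * real (c k) ^ m k * real (num_colourings d c m k (n - m k)))
      \<sim>[sequentially] (\<lambda>n. (real n ^ m k / fact (m k)) * real (c k) ^ m k *
      (?P * real (n - m k) ^ ?M * real d ^ (n - m k)))"
    by (intro asymp_equiv_mult[OF _ asymp_equiv_compose'[OF Suc.IH lim]]
        asymp_equiv_mult[OF _ asymp_equiv_refl] asymp_equiv_binomial)
  moreover have "(\<lambda>n. (real n ^ m k / fact (m k)) * real (c k) ^ m k *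
      (?P * real (n - m k) ^ ?M * real d ^ (n - m k)))
    \<sim>[sequentially] (\<lambda>n. (real n ^ m k / fact (m k)) * real (c k) ^ m k *
      (?P * real n ^ ?M * (real d ^ n / real d ^ m k)))"
    by (rule asymp_equiv_mult[OF asymp_equiv_refl
        asymp_equiv_mult[OF asymp_equiv_mult[OF asymp_equiv_refl pow] geo]])
  ultimately have "(\<lambda>n. real (n choose m k) * real (c k) ^ m k * real (num_colourings d c m k (n - m k)))
      \<sim>[sequentially] (\<lambda>n. (real n ^ m k / fact (m k)) * real (c k) ^ m k *
      (?P * real n ^ ?M * (real d ^ n / real d ^ m k)))"
    by (rule asymp_equiv_trans)
  moreover have "(real n ^ m k / fact (m k)) * real (c k) ^ m k * (?P * real n ^ ?M * (real d ^ n / real d ^ m k))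
      = (\<Prod>j<Suc k. real (c j) ^ m j / (fact (m j) * real d ^ m j)) *
        real n ^ (\<Sum>j<Suc k. m j) * real d ^ n" for n
    by (simp add: power_add)
  ultimately have "(\<lambda>n. real (n choose m k) * real (c k) ^ m k * real (num_colourings d c m k (n - m k)))
      \<sim>[sequentially] (\<lambda>n. (\<Prod>j<Suc k. real (c j) ^ m j / (fact (m j) * real d ^ m j)) *
        real n ^ (\<Sum>j<Suc k. m j) * real d ^ n)"
    by (simp only:)
  then show ?case by simp
qed simp

text \<open>The ratio of the two sides is eventually between 1/2 and 2, so its n-th root tends to 1,
  as do the n-th roots of \<open>K\<close> and of n. Only the root of \<open>q ^ n\<close>
  remains.\<close>

lemma root_tendsto_of_asymp_equiv:
  fixes f :: "nat \<Rightarrow> real"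
  assumes f: "f \<sim>[sequentially] (\<lambda>n. K * real n ^ M * q ^ n)" and "K > 0" "q > 0"
  shows "(\<lambda>n. root n (f n)) \<longlonglongrightarrow> q"
proof -
  define R where "R n = f n / (K * real n ^ M * q ^ n)" for n
  have "R \<longlonglongrightarrow> 1"
    unfolding R_def
    by (rule asymp_equivD_strong[OF f], rule eventually_mono[OF eventually_gt_at_top[of 0]])
      (use assms in simp)
  from order_tendstoD(1)[OF this, of "1/2"] order_tendstoD(2)[OF this, of 2]
  have ev: "eventually (\<lambda>n. R n > 1/2) sequentially" "eventually (\<lambda>n. R n < 2) sequentially"
    by simp_all
  have "(\<lambda>n. root n (R n)) \<longlonglongrightarrow> 1"
  proof (rule tendsto_sandwich)
    show "eventually (\<lambda>n. root n (1/2) \<le> root n (R n)) sequentially"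
      using ev(1) eventually_gt_at_top[of "0::nat"] by eventually_elim (simp add: real_root_le_iff)
    show "eventually (\<lambda>n. root n (R n) \<le> root n 2) sequentially"
      using ev(2) eventually_gt_at_top[of "0::nat"] by eventually_elim (simp add: real_root_le_iff)
    show "(\<lambda>n. root n (1/2)) \<longlonglongrightarrow> 1" "(\<lambda>n. root n 2) \<longlonglongrightarrow> 1"
      by (rule LIMSEQ_root_const; simp)+
  qed
  then have "(\<lambda>n. root n (R n) * root n K * root n (real n) ^ M * q) \<longlonglongrightarrow> 1 * 1 * 1 ^ M * q"
    using assms by (intro tendsto_mult tendsto_power LIMSEQ_root LIMSEQ_root_const tendsto_const)
  moreover have "eventually (\<lambda>n. root n (R n) * root n K * root n (real n) ^ M * q = root n (f n)) sequentially"
    using eventually_gt_at_top[of "0::nat"]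
  proof eventually_elim
    case (elim n)
    have "f n = R n * K * real n ^ M * q ^ n" using elim assms by (simp add: R_def)
    then show ?case using elim assms
      by (simp add: real_root_mult real_root_power real_root_power_cancel)
  qed
  ultimately show ?thesis by (simp add: Lim_transform_eventually)
qed

section \<open>Substitutions and paths\<close>

lemma ut_alg_simps:
  "carrier (ut_alg m) = {M \<in> carrier_mat m m. upper_triangular M}"
  "mult (ut_alg m) = (*)" "one (ut_alg m) = 1\<^sub>m m" "zero (ut_alg m) = 0\<^sub>m m m"
  "add (ut_alg m) = (+)" "smult (ut_alg m) = (\<cdot>\<^sub>m)"
  by (simp_all add: ut_alg_def module_mat_def)

lemma vectorspace_ut_alg: "vectorspace class_ring (ut_alg m :: ('k::field, 'k mat) module)"
proof (rule vs_criteria)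
  show "field (class_ring :: 'k ring)" by (rule class_field)
  show "\<forall>v\<in>carrier (ut_alg m). \<exists>neg_v\<in>carrier (ut_alg m). v \<oplus>\<^bsub>ut_alg m\<^esub> neg_v = \<zero>\<^bsub>ut_alg m :: ('k, 'k mat) module\<^esub>"
  proof
    fix v :: "'k mat" assume "v \<in> carrier (ut_alg m)"
    then show "\<exists>neg_v\<in>carrier (ut_alg m). v \<oplus>\<^bsub>ut_alg m\<^esub> neg_v = \<zero>\<^bsub>ut_alg m :: ('k, 'k mat) module\<^esub>"
      by (intro bexI[of _ "- v"]) (auto simp: ut_alg_simps upper_triangular_def)
  qed
qed (auto simp: ut_alg_simps upper_triangular_def algebra_simps intro!: eq_matI)

lemma finsum_ut_alg_index:
  fixes f :: "'i \<Rightarrow> 'k::field mat"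
  assumes "\<And>w. w \<in> K \<Longrightarrow> f w \<in> carrier (ut_alg m)" "p < m" "q < m" "finite K"
  shows "finsum (ut_alg m) f K \<in> carrier (ut_alg m) \<and> finsum (ut_alg m) f K $$ (p, q) = (\<Sum>w\<in>K. f w $$ (p, q))"
proof -
  interpret vectorspace class_ring "ut_alg m :: ('k, 'k mat) module" by (rule vectorspace_ut_alg)
  have "f \<in> K \<rightarrow> carrier (ut_alg m) \<Longrightarrow> finsum (ut_alg m) f K $$ (p, q) = (\<Sum>w\<in>K. f w $$ (p, q))"
    using assms(4)
  proof (induction K rule: finite_induct)
    case empty
    then show ?case using assms(2,3) M.finsum_empty[of f] by (simp add: ut_alg_simps del: M.finsum_empty)
  next
    case (insert x F)
    then have "finsum (ut_alg m) f F \<in> carrier (ut_alg m)" by (intro M.finsum_closed) auto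
    moreover have "finsum (ut_alg m) f (Set.insert x F) = f x \<oplus>\<^bsub>ut_alg m\<^esub> finsum (ut_alg m) f F"
      using insert by (intro M.finsum_insert) auto
    ultimately show ?case using insert assms(2,3) by (auto simp: ut_alg_simps)
  qed
  then show ?thesis using assms(1) by (auto intro: M.finsum_closed)
qed

text \<open>The diagonal of D: conjugation by D multiplies the entry at (p, q) by the signs of p and
  q.\<close>

definition half_sign :: "nat \<Rightarrow> nat \<Rightarrow> 'k::field" where
  "half_sign r i = (if i < r then 1 else - 1)"

text \<open>The action of the reflection on positions. With rows counted from 0, the index 2r + 1 -
  j becomes \<open>m - 1 - j\<close>.\<close>

definition mirror :: "nat \<Rightarrow> nat \<times> nat \<Rightarrow> nat \<times> nat" where
  "mirror m P = (m - 1 - snd P, m - 1 - fst P)"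

definition pairs :: "nat \<Rightarrow> (nat \<times> nat) set" where
  "pairs m = {(k, l). k \<le> l \<and> l < m}"

definition pair_degree :: "nat \<Rightarrow> nat \<times> nat \<Rightarrow> int vec" where
  "pair_degree r P = finest_seq r (fst P) - finest_seq r (snd P)"

lemma symplectic_inv_dim [simp]:
  "symplectic_inv r M \<in> carrier_mat (2 * r) (2 * r)"
  unfolding symplectic_inv_def
  by (intro mult_carrier_mat[where n = "2 * r"]) (auto simp: symplectic_diag_def mat_diag_def reflection_def)

lemma symplectic_inv_index:
  assumes "p < 2 * r" "q < 2 * r"
  shows "symplectic_inv r M $$ (p, q) = half_sign r p * half_sign r q * M $$ mirror (2 * r) (p, q)"
proof -
  have R: "reflection (2 * r) M \<in> carrier_mat (2 * r) (2 * r)" by (simp add: reflection_def)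
  have "symplectic_inv r M = mat (2 * r) (2 * r) (\<lambda>(i, j). half_sign r j *
      mat (2 * r) (2 * r) (\<lambda>(i, j). half_sign r i * reflection (2 * r) M $$ (i, j)) $$ (i, j))"
    unfolding symplectic_inv_def symplectic_diag_def mat_diag_mult_left[OF R]
    by (subst mat_diag_mult_right[where n = "2 * r"])
      (auto simp: half_sign_def mult.commute intro!: eq_matI)
  then show ?thesis using assms by (simp add: reflection_def mirror_def mult_ac)
qed

lemma symplectic_inv_upper_triangular:
  assumes "upper_triangular M" "M \<in> carrier_mat (2 * r) (2 * r)"
  shows "upper_triangular (symplectic_inv r M)"
proof (unfold upper_triangular_def, intro allI impI)
  fix i j assume "i < dim_row (symplectic_inv r M)" "j < i"
  then have ij: "i < 2 * r" "j < i" using symplectic_inv_dim[of r M] by auto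
  then have "M $$ (2 * r - 1 - j, 2 * r - 1 - i) = 0"
    using assms by (intro upper_triangularD) auto
  then show "symplectic_inv r M $$ (i, j) = 0"
    using ij by (simp add: symplectic_inv_index mirror_def)
qed

lemma finest_seq_dim [simp]: "dim_vec (finest_seq r i) = r"
  by (simp add: finest_seq_def)

text \<open>The members of \<open>finest_seq\<close> are pairwise distinct. What this provides
  later: the degree of a letter alone tells whether the unit put in its place is diagonal.\<close>

lemma pair_degree_eq_zero_iff:
  assumes "P \<in> pairs (2 * r)"
  shows "pair_degree r P = 0\<^sub>v r \<longleftrightarrow> fst P = snd P"
proof
  assume *: "pair_degree r P = 0\<^sub>v r"
  obtain k l where P: "P = (k, l)" by (cases P)
  have kl: "k \<le> l" "l < 2 * r" using assms by (auto simp: P pairs_def)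
  have eq: "finest_seq r k $ i = finest_seq r l $ i" if "i < r" for i
  proof -
    have "pair_degree r P $ i = 0" using * that by simp
    then show ?thesis using that by (simp add: pair_degree_def P)
  qed
  show "fst P = snd P"
  proof (rule ccontr)
    assume "fst P \<noteq> snd P"
    then have "k < l" using kl by (auto simp: P)
    \<comment> \<open>Coordinate k separates the first two cases; in the second, the member at l = r
      is the zero vector. For l > r the member at l has -1 in coordinate 2r - 1 - l, where those
      before it have 0 or 1.\<close>
    then consider "l < r" | "k < r" "l \<ge> r" "2 * r - 1 - l = r - 1" | "k < r" "l \<ge> r" "2 * r - 1 - l < r - 1" | "k \<ge> r"
      using kl by linarith
    then show False
    proof cases
      case 1
      then show False using eq[of k] \<open>k < l\<close> by (auto simp: finest_seq_def)
    next
      case 2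
      then show False using eq[of k] \<open>k < l\<close> by (auto simp: finest_seq_def)
    next
      case 3
      moreover have "2 * r - 1 - l < r" using 3 by linarith
      ultimately show False using eq[of "2 * r - 1 - l"] \<open>k < l\<close> by (auto simp: finest_seq_def split: if_splits)
    next
      case 4
      have *: "2 * r - 1 - l < r" "2 * r - 1 - l \<noteq> 2 * r - 1 - k" "2 * r - 1 - l \<noteq> r - 1 \<or> l = r"
        using 4 kl \<open>k < l\<close> by linarith+
      then show False using eq[of "2 * r - 1 - l"] 4 \<open>k < l\<close> by (auto simp: finest_seq_def split: if_splits)
    qed
  qed
qed (auto simp: pair_degree_def)

lemma mirror_pairs: "P \<in> pairs m \<Longrightarrow> mirror m P \<in> pairs m"
  by (auto simp: mirror_def pairs_def)

lemma mirror_mirror: "fst P < m \<Longrightarrow> snd P < m \<Longrightarrow> mirror m (mirror m P) = P"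
  by (auto simp: mirror_def prod_eq_iff)

lemma pairs_bounds: "P \<in> pairs m \<Longrightarrow> fst P < m \<and> snd P < m"
  by (auto simp: pairs_def)

lemma finite_pairs [simp]: "finite (pairs m)"
  by (rule finite_subset[of _ "{..<m} \<times> {..<m}"]) (auto simp: pairs_def)

lemma elem_mat_carrier: "P \<in> pairs m \<Longrightarrow> elem_mat m (fst P) (snd P) \<in> carrier (ut_alg m)"
  by (auto simp: ut_alg_simps elem_mat_def pairs_def upper_triangular_def)

lemma finest_component_eq:
  "finest_component r g = LinearCombinations.module.span class_ring (ut_alg (2 * r))
     ((\<lambda>P. elem_mat (2 * r) (fst P) (snd P)) ` {P \<in> pairs (2 * r). pair_degree r P = g})"
  unfolding finest_component_def
  by (intro arg_cong[where f = "LinearCombinations.module.span class_ring (ut_alg (2 * r))"])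
    (force simp: pairs_def pair_degree_def)

lemma elem_mat_in_finest_component:
  assumes "P \<in> pairs (2 * r)"
  shows "elem_mat (2 * r) (fst P) (snd P) \<in> (finest_component r (pair_degree r P) :: 'k::field mat set)"
proof -
  interpret vectorspace class_ring "ut_alg (2 * r) :: ('k, 'k mat) module" by (rule vectorspace_ut_alg)
  show ?thesis unfolding finest_component_eq
    by (rule subsetD[OF in_own_span]) (use assms elem_mat_carrier in auto)
qed

lemma finest_component_zero: "0\<^sub>m (2 * r) (2 * r) \<in> (finest_component r g :: 'k::field mat set)"
proof -
  interpret vectorspace class_ring "ut_alg (2 * r) :: ('k, 'k mat) module" by (rule vectorspace_ut_alg)
  show ?thesis unfolding finest_component_eq using span_zero by (simp add: ut_alg_simps)
qed

text \<open>Matrices supported on positions of degree \<open>g\<close> form a subspace. It contains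
  the spanning matrix units, hence also their span.\<close>

lemma finest_componentD:
  assumes "M \<in> (finest_component r g :: 'k::field mat set)"
  shows "M \<in> carrier (ut_alg (2 * r))"
    and "P \<in> pairs (2 * r) \<Longrightarrow> M $$ P \<noteq> 0 \<Longrightarrow> pair_degree r P = g"
proof -
  interpret vectorspace class_ring "ut_alg (2 * r) :: ('k, 'k mat) module" by (rule vectorspace_ut_alg)
  let ?U = "{M \<in> carrier (ut_alg (2 * r) :: ('k, 'k mat) module).
    \<forall>P\<in>pairs (2 * r). M $$ P \<noteq> 0 \<longrightarrow> pair_degree r P = g}"
  have idx: "(u + v) $$ P = u $$ P + v $$ P" "(c \<cdot>\<^sub>m u) $$ P = c * u $$ P"
    if "u \<in> carrier_mat (2 * r) (2 * r)" "v \<in> carrier_mat (2 * r) (2 * r)" "P \<in> pairs (2 * r)" 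
    for u v :: "'k mat" and c P
    using that by (auto simp: pairs_def)
  have U: "submodule class_ring ?U (ut_alg (2 * r))"
  proof (rule submodule.intro)
    show "module class_ring (ut_alg (2 * r) :: ('k, 'k mat) module)" by (rule module_axioms)
    show "\<zero>\<^bsub>ut_alg (2 * r)\<^esub> \<in> ?U" using M.zero_closed by (auto simp: ut_alg_simps pairs_def)
    show "u \<oplus>\<^bsub>ut_alg (2 * r)\<^esub> v \<in> ?U" if "u \<in> ?U" "v \<in> ?U" for u v
      using that M.a_closed[of u v] idx(1)[of u v] by (auto simp: ut_alg_simps)
    show "c \<odot>\<^bsub>ut_alg (2 * r)\<^esub> u \<in> ?U" if "u \<in> ?U" for c u
      using that smult_closed[of c u] idx(2)[of u u _ c] by (auto simp: ut_alg_simps)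
  qed auto
  have "(\<lambda>P. elem_mat (2 * r) (fst P) (snd P)) ` {P \<in> pairs (2 * r). pair_degree r P = g} \<subseteq> ?U"
    using elem_mat_carrier by (fastforce simp: elem_mat_def pairs_def split: if_splits)
  then have "finest_component r g \<subseteq> ?U"
    unfolding finest_component_eq by (rule span_is_subset[OF _ U])
  then show "M \<in> carrier (ut_alg (2 * r))"
    "P \<in> pairs (2 * r) \<Longrightarrow> M $$ P \<noteq> 0 \<Longrightarrow> pair_degree r P = g"
    using assms by auto
qed

section \<open>Values of words and their expansion in matrix units\<close>

text \<open>An entry of a product of matrices that are given by plain functions on positions, so
  that no carrier conditions accompany the expansion.\<close>

fun word_entry :: "nat \<Rightarrow> ('x \<Rightarrow> nat \<times> nat \<Rightarrow> 'k::field) \<Rightarrow> 'x list \<Rightarrow> nat \<Rightarrow> nat \<Rightarrow> 'k" where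
  "word_entry m e [] p q = (if p = q then 1 else 0)"
| "word_entry m e (x # w) p q = (\<Sum>l<m. e x (p, l) * word_entry m e w l q)"

definition letter_entry :: "nat \<Rightarrow> (nat \<times> nat \<Rightarrow> 'k::field) \<Rightarrow> bool \<Rightarrow> nat \<times> nat \<Rightarrow> 'k" where
  "letter_entry r M s P =
     (if s then half_sign r (fst P) * half_sign r (snd P) * M (mirror (2 * r) P) else M P)"

lemma word_val_index:
  assumes "\<And>i g. g \<in> degree ` set w \<Longrightarrow> a i g \<in> carrier (ut_alg (2 * r))"
  shows "word_val (ut_alg (2 * r)) (symplectic_inv r) a w \<in> carrier (ut_alg (2 * r)) \<and>
    (\<forall>p q. p < 2 * r \<longrightarrow> q < 2 * r \<longrightarrow> word_val (ut_alg (2 * r)) (symplectic_inv r) a w $$ (p, q) =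
      word_entry (2 * r) (\<lambda>x. letter_entry r (($$) (a (index x) (degree x))) (starred x)) w p q)"
  using assms
proof (induction w)
  case Nil
  then show ?case by (auto simp: word_val_def ut_alg_simps upper_triangular_def)
next
  case (Cons x w)
  let ?X = "indet_val (symplectic_inv r) a x" and ?W = "word_val (ut_alg (2 * r)) (symplectic_inv r) a w"
  have W: "?W \<in> carrier_mat (2 * r) (2 * r)" "upper_triangular ?W"
    "\<And>p q. p < 2 * r \<Longrightarrow> q < 2 * r \<Longrightarrow> ?W $$ (p, q) =
      word_entry (2 * r) (\<lambda>x. letter_entry r (($$) (a (index x) (degree x))) (starred x)) w p q"
    using Cons by (auto simp: ut_alg_simps)
  have a: "a (index x) (degree x) \<in> carrier_mat (2 * r) (2 * r)" "upper_triangular (a (index x) (degree x))"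
    using Cons.prems by (auto simp: ut_alg_simps)
  have X: "?X \<in> carrier_mat (2 * r) (2 * r)" "upper_triangular ?X"
    using a symplectic_inv_upper_triangular by (cases x; auto)+
  have Xi: "?X $$ P = letter_entry r (($$) (a (index x) (degree x))) (starred x) P"
    if "fst P < 2 * r" "snd P < 2 * r" for P
    using that by (cases x; cases P) (auto simp: letter_entry_def symplectic_inv_index)
  have eq: "word_val (ut_alg (2 * r)) (symplectic_inv r) a (x # w) = ?X * ?W"
    by (simp add: word_val_def ut_alg_simps)
  have ent: "(?X * ?W) $$ (p, q) = (\<Sum>l<2 * r. ?X $$ (p, l) * ?W $$ (l, q))"
    if "p < 2 * r" "q < 2 * r" for p q
    using that X W by (auto simp: scalar_prod_def atLeast0LessThan intro!: sum.cong)
  have "(?X * ?W) $$ (p, q) = 0" if "q < p" "p < 2 * r" for p q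
  proof -
    have "?X $$ (p, l) * ?W $$ (l, q) = 0" if "l < 2 * r" for l
      using upper_triangularD[OF X(2), of l p] upper_triangularD[OF W(2), of q l] X W that \<open>q < p\<close> \<open>p < 2 * r\<close>
      by (cases "l < p") auto
    then show ?thesis using that by (auto simp: ent intro!: sum.neutral)
  qed
  then have "upper_triangular (?X * ?W)" using X W by (auto simp: upper_triangular_def)
  moreover have "?X * ?W \<in> carrier_mat (2 * r) (2 * r)" using X W by auto
  ultimately show ?case unfolding eq using ent W(3) Xi by (auto simp: ut_alg_simps intro!: sum.cong)
qed

text \<open>A multilinear polynomial may use the index i with different degrees in different
  monomials. A position is therefore assigned to i alone, and the test on \<open>g\<close> makes
  this an admissible value for all the variables with index i at once.\<close>

definition unit_entry :: "nat \<Rightarrow> nat \<times> nat \<Rightarrow> int vec \<Rightarrow> nat \<times> nat \<Rightarrow> 'k::field" where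
  "unit_entry r P g Q = (if Q = P \<and> P \<in> pairs (2 * r) \<and> pair_degree r P = g then 1 else 0)"

definition basis_letter ::
  "nat \<Rightarrow> (nat \<Rightarrow> nat \<times> nat) \<Rightarrow> int vec indet \<Rightarrow> nat \<times> nat \<Rightarrow> 'k::field" where
  "basis_letter r b x = letter_entry r (unit_entry r (b (index x)) (degree x)) (starred x)"

text \<open>The coefficient takes its degree from \<open>P\<close> and not from \<open>g\<close>.
  The two agree on positions of degree \<open>g\<close>, and on all others \<open>unit_entry\<close>
  is 0.\<close>

lemma letter_entry_expand:
  assumes M: "\<And>P. P \<in> {..<2 * r} \<times> {..<2 * r} \<Longrightarrow> M g P \<noteq> 0 \<Longrightarrow> P \<in> pairs (2 * r) \<and> pair_degree r P = g"
    and "p < 2 * r" "l < 2 * r"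
  shows "letter_entry r (M g) s (p, l) =
    (\<Sum>P\<in>pairs (2 * r). M (pair_degree r P) P * letter_entry r (unit_entry r P g) s (p, l))"
proof -
  define \<sigma> :: 'a where "\<sigma> = (if s then half_sign r p * half_sign r l else 1)"
  define Q where "Q = (if s then mirror (2 * r) (p, l) else (p, l))"
  have Q: "Q \<in> {..<2 * r} \<times> {..<2 * r}" using assms by (auto simp: Q_def mirror_def)
  have le: "letter_entry r N s (p, l) = \<sigma> * N Q" for N
    by (simp add: letter_entry_def \<sigma>_def Q_def)
  have "(\<Sum>P\<in>pairs (2 * r). M (pair_degree r P) P * (\<sigma> * unit_entry r P g Q)) =
    (\<Sum>P\<in>pairs (2 * r). if P = Q then (if pair_degree r Q = g then \<sigma> * M g Q else 0) else 0)"
    by (intro sum.cong) (auto simp: unit_entry_def)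
  also have "\<dots> = \<sigma> * M g Q" using M[OF Q] by auto
  finally show ?thesis by (simp add: le)
qed

lemma word_entry_cong:
  assumes "\<And>x p l. x \<in> set w \<Longrightarrow> p < m \<Longrightarrow> l < m \<Longrightarrow> e x (p, l) = e' x (p, l)" "p < m"
  shows "word_entry m e w p q = word_entry m e' w p q"
  using assms by (induction w arbitrary: p) auto

text \<open>Multilinear expansion, letter by letter. Since the indices are distinct, a map on the
  enlarged index set is a map on the old one together with a position for the new index. The
  coefficient of \<open>b\<close> depends on the set of indices but not on the word, so it can later
  be pulled out of a sum over monomials.\<close>

lemma word_entry_expand:
  fixes M :: "nat \<Rightarrow> int vec \<Rightarrow> nat \<times> nat \<Rightarrow> 'k::field"
  assumes M: "\<And>i g P. g \<in> degree ` set w \<Longrightarrow> P \<in> {..<2 * r} \<times> {..<2 * r} \<Longrightarrow> M i g P \<noteq> 0 \<Longrightarrow>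
      P \<in> pairs (2 * r) \<and> pair_degree r P = g"
    and "distinct (map index w)" "p < 2 * r" "q < 2 * r"
  shows "word_entry (2 * r) (\<lambda>x. letter_entry r (M (index x) (degree x)) (starred x)) w p q =
    (\<Sum>b\<in>index ` set w \<rightarrow>\<^sub>E pairs (2 * r). (\<Prod>i\<in>index ` set w. M i (pair_degree r (b i)) (b i)) *
      word_entry (2 * r) (basis_letter r b) w p q)"
  using assms
proof (induction w arbitrary: p)
  case Nil
  then show ?case by simp
next
  case (Cons x w)
  let ?i = "index x" and ?I = "index ` set w" and ?\<Pi> = "pairs (2 * r)"
  let ?e = "\<lambda>x. letter_entry r (M (index x) (degree x)) (starred x)"
  let ?c = "\<lambda>i P. M i (pair_degree r P) P"
  let ?u = "\<lambda>P. letter_entry r (unit_entry r P (degree x)) (starred x) :: nat \<times> nat \<Rightarrow> 'k"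
  have i: "?i \<notin> ?I" using Cons.prems by auto
  have IH: "word_entry (2 * r) ?e w l q =
      (\<Sum>b\<in>?I \<rightarrow>\<^sub>E ?\<Pi>. (\<Prod>i\<in>?I. ?c i (b i)) * word_entry (2 * r) (basis_letter r b) w l q)"
    if "l < 2 * r" for l
  proof (rule Cons.IH)
    show "P \<in> ?\<Pi> \<and> pair_degree r P = g"
      if "g \<in> degree ` set w" "P \<in> {..<2 * r} \<times> {..<2 * r}" "M i g P \<noteq> 0" for i g P
      using Cons.prems(1)[of g P i] that by simp
  qed (use Cons.prems that in auto)
  have ne: "index y \<noteq> ?i" if "y \<in> set w" for y using i that by (metis imageI)
  have upd: "(\<Prod>j\<in>insert ?i ?I. ?c j ((b(?i := P)) j)) *
      word_entry (2 * r) (basis_letter r (b(?i := P))) (x # w) p q =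
      (\<Sum>l<2 * r. ?c ?i P * ?u P (p, l) * ((\<Prod>j\<in>?I. ?c j (b j)) * word_entry (2 * r) (basis_letter r b) w l q))"
    for b P
  proof -
    have "(\<Prod>j\<in>?I. ?c j ((b(?i := P)) j)) = (\<Prod>j\<in>?I. ?c j (b j))"
      using ne by (intro prod.cong) auto
    moreover have "word_entry (2 * r) (basis_letter r (b(?i := P))) w l q = (word_entry (2 * r) (basis_letter r b) w l q :: 'k)"
      if "l < 2 * r" for l
      using ne that by (intro word_entry_cong) (auto simp: basis_letter_def)
    moreover have "basis_letter r (b(?i := P)) x = ?u P" by (auto simp: basis_letter_def)
    ultimately show ?thesis using i unfolding word_entry.simps sum_distrib_left
      by (intro sum.cong refl) (simp add: mult_ac)
  qed
  have "word_entry (2 * r) ?e (x # w) p q =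
      (\<Sum>l<2 * r. (\<Sum>P\<in>?\<Pi>. ?c ?i P * ?u P (p, l)) *
        (\<Sum>b\<in>?I \<rightarrow>\<^sub>E ?\<Pi>. (\<Prod>i\<in>?I. ?c i (b i)) * word_entry (2 * r) (basis_letter r b) w l q))"
  proof -
    have "?e x (p, l) = (\<Sum>P\<in>?\<Pi>. ?c ?i P * ?u P (p, l))" if "l < 2 * r" for l
      by (rule letter_entry_expand[OF Cons.prems(1)]) (use that Cons.prems in auto)
    then show ?thesis using IH by simp
  qed
  also have "\<dots> = (\<Sum>l<2 * r. \<Sum>P\<in>?\<Pi>. \<Sum>b\<in>?I \<rightarrow>\<^sub>E ?\<Pi>. ?c ?i P * ?u P (p, l) *
        ((\<Prod>j\<in>?I. ?c j (b j)) * word_entry (2 * r) (basis_letter r b) w l q))"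
    by (simp only: sum_product)
  also have "\<dots> = (\<Sum>P\<in>?\<Pi>. \<Sum>b\<in>?I \<rightarrow>\<^sub>E ?\<Pi>. \<Sum>l<2 * r. ?c ?i P * ?u P (p, l) *
        ((\<Prod>j\<in>?I. ?c j (b j)) * word_entry (2 * r) (basis_letter r b) w l q))"
    by (subst sum.swap, intro sum.cong refl, rule sum.swap)
  also have "\<dots> = (\<Sum>(P, b)\<in>?\<Pi> \<times> (?I \<rightarrow>\<^sub>E ?\<Pi>). (\<Prod>j\<in>insert ?i ?I. ?c j ((b(?i := P)) j)) *
      word_entry (2 * r) (basis_letter r (b(?i := P))) (x # w) p q)"
    unfolding upd by (rule sum.cartesian_product)
  also have "\<dots> = (\<Sum>b\<in>(\<lambda>(P, b). b(?i := P)) ` (?\<Pi> \<times> (?I \<rightarrow>\<^sub>E ?\<Pi>)). (\<Prod>j\<in>insert ?i ?I. ?c j (b j)) *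
      word_entry (2 * r) (basis_letter r b) (x # w) p q)"
    by (subst sum.reindex[OF inj_combinator[OF i]]) (simp add: case_prod_beta o_def)
  also have "(\<lambda>(P, b). b(?i := P)) ` (?\<Pi> \<times> (?I \<rightarrow>\<^sub>E ?\<Pi>)) = insert ?i ?I \<rightarrow>\<^sub>E ?\<Pi>"
    by (simp add: PiE_insert_eq)
  finally show ?case by simp
qed

section \<open>Nonvanishing words and paths\<close>

fun is_path :: "(nat \<times> nat) list \<Rightarrow> nat \<Rightarrow> nat \<Rightarrow> bool" where
  "is_path [] p q \<longleftrightarrow> p = q"
| "is_path (P # es) p q \<longleftrightarrow> fst P = p \<and> is_path es (snd P) q"

abbreviation off_diagonal :: "nat \<times> nat \<Rightarrow> bool" where
  "off_diagonal P \<equiv> fst P \<noteq> snd P"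

text \<open>Up to sign, the involution maps the matrix unit at \<open>P\<close> to the one at \<open>mirror (2 * r) P\<close>, so a
  letter takes the value of the matrix unit at its edge, up to sign.\<close>

definition edge :: "nat \<Rightarrow> (nat \<Rightarrow> nat \<times> nat) \<Rightarrow> 'g indet \<Rightarrow> nat \<times> nat" where
  "edge r b x = (if starred x then mirror (2 * r) (b (index x)) else b (index x))"

lemma basis_letter_nonzero_iff:
  assumes "p < 2 * r" "l < 2 * r"
  shows "(basis_letter r b x (p, l) :: 'k::field) \<noteq> 0 \<longleftrightarrow>
    b (index x) \<in> pairs (2 * r) \<and> pair_degree r (b (index x)) = degree x \<and> edge r b x = (p, l)"
proof -
  let ?P = "b (index x)" and ?Q = "if starred x then mirror (2 * r) (p, l) else (p, l)"
  define \<sigma> :: 'k where "\<sigma> = (if starred x then half_sign r p * half_sign r l else 1)"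
  have "basis_letter r b x (p, l) = \<sigma> * unit_entry r ?P (degree x) ?Q"
    by (simp add: basis_letter_def letter_entry_def \<sigma>_def)
  moreover have "\<sigma> \<noteq> 0" by (simp add: \<sigma>_def half_sign_def)
  moreover have "?Q = ?P \<longleftrightarrow> edge r b x = (p, l)" if P: "?P \<in> pairs (2 * r)"
  proof (cases "starred x")
    case True
    have "mirror (2 * r) (p, l) = ?P \<longleftrightarrow> mirror (2 * r) ?P = (p, l)"
      using mirror_mirror[of "(p, l)" "2 * r"] mirror_mirror[of ?P "2 * r"] pairs_bounds[OF P] assms
      by (metis fst_conv snd_conv)
    then show ?thesis using True by (simp add: edge_def)
  qed (auto simp: edge_def)
  ultimately show ?thesis
    by (cases "?P \<in> pairs (2 * r)"; cases "pair_degree r ?P = degree x"; cases "edge r b x = (p, l)")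
      (simp_all add: unit_entry_def)
qed

lemma edge_pairs: "b (index x) \<in> pairs (2 * r) \<Longrightarrow> edge r b x \<in> pairs (2 * r)"
  by (simp add: edge_def mirror_pairs)

text \<open>A letter has at most one nonzero entry, so each sum over the middle index has at most
  one nonzero term and nothing can cancel.\<close>

lemma word_entry_nonzero_iff:
  assumes "p < 2 * r" "q < 2 * r"
  shows "(word_entry (2 * r) (basis_letter r b) w p q :: 'k::field) \<noteq> 0 \<longleftrightarrow>
    is_path (map (edge r b) w) p q \<and>
    (\<forall>x\<in>set w. b (index x) \<in> pairs (2 * r) \<and> pair_degree r (b (index x)) = degree x)"
  using assms(1)
proof (induction w arbitrary: p)
  case (Cons x w)
  let ?ok = "b (index x) \<in> pairs (2 * r) \<and> pair_degree r (b (index x)) = degree x"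
  let ?f = "\<lambda>l. basis_letter r b x (p, l) * word_entry (2 * r) (basis_letter r b) w l q :: 'k"
  show ?case
  proof (cases ?ok)
    case True
    define l where "l = snd (edge r b x)"
    have l: "l < 2 * r" using edge_pairs True pairs_bounds unfolding l_def by blast
    have "?f l' = 0" if "l' \<in> {..<2 * r} - {l}" for l'
      using basis_letter_nonzero_iff[of p r l' b x] Cons.prems that by (auto simp: l_def)
    then have "(\<Sum>l\<in>{..<2 * r} - {l}. ?f l) = 0" by (intro sum.neutral ballI)
    then have "(\<Sum>l<2 * r. ?f l) = ?f l" using l by (subst sum.remove[of _ l]) auto
    moreover have "?f l \<noteq> 0 \<longleftrightarrow> fst (edge r b x) = p \<and> word_entry (2 * r) (basis_letter r b) w l q \<noteq> (0 :: 'k)"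
      using basis_letter_nonzero_iff[where 'k = 'k, OF Cons.prems l, of b x] True
      by (auto simp: l_def prod_eq_iff)
    ultimately show ?thesis using Cons.IH[OF l] True by (simp add: l_def)
  next
    case False
    then have "?f l = 0" if "l < 2 * r" for l
      using basis_letter_nonzero_iff[where 'k = 'k, OF Cons.prems that, of b x] by auto
    then have "(\<Sum>l<2 * r. ?f l) = 0" by (intro sum.neutral) auto
    then show ?thesis using False by auto
  qed
qed simp

text \<open>No edge in \<open>pairs m\<close> goes down, and each off-diagonal one goes up by at
  least 1.\<close>

lemma is_path_off_diagonal_le:
  assumes "is_path es p q" "set es \<subseteq> pairs m"
  shows "p + length (filter off_diagonal es) \<le> q"
  using assms
proof (induction es arbitrary: p)
  case (Cons P es)
  from Cons.IH[of "snd P"] Cons.prems show ?case by (auto simp: pairs_def)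
qed simp

text \<open>Equality in the bound leaves no room for an edge that rises by more than 1.\<close>

lemma is_path_tight:
  assumes "is_path es p q" "set es \<subseteq> pairs m" "q = p + length (filter off_diagonal es)"
  shows "filter off_diagonal es = map (\<lambda>k. (k, Suc k)) [p..<q]"
  using assms
proof (induction es arbitrary: p)
  case (Cons P es)
  have le: "snd P + length (filter off_diagonal es) \<le> q"
    using is_path_off_diagonal_le[of es "snd P" q] Cons.prems by auto
  show ?case
  proof (cases "off_diagonal P")
    case True
    then have "snd P = Suc p" using Cons.prems le by (auto simp: pairs_def)
    moreover have "filter off_diagonal es = map (\<lambda>k. (k, Suc k)) [snd P..<q]"
      using Cons.prems True le \<open>snd P = Suc p\<close> by (intro Cons.IH) auto
    moreover have "p < q" using Cons.prems True by auto
    moreover have "P = (p, Suc p)" using Cons.prems(1) \<open>snd P = Suc p\<close> by (simp add: prod_eq_iff)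
    ultimately show ?thesis by (simp add: upt_conv_Cons del: upt_Suc)
  next
    case False
    then show ?thesis using Cons by auto
  qed
qed simp

text \<open>The common pattern gives the second path as many off-diagonal edges as the first, so it
  is tight too. In a tight path the pattern decides each edge: stay, or rise by exactly 1.\<close>

lemma is_path_tight_unique:
  assumes "is_path es p q" "set es \<subseteq> pairs m" "q = p + length (filter off_diagonal es)"
    and "is_path es' p q" "set es' \<subseteq> pairs m"
    and "list_all2 (\<lambda>P P'. off_diagonal P \<longleftrightarrow> off_diagonal P') es es'"
  shows "es = es'"
  using assms(6,1-5)
proof (induction arbitrary: p rule: list_all2_induct)
  case (Cons P es P' es')
  have len: "length (filter off_diagonal es) = length (filter off_diagonal es')"
    using Cons.hyps(2) by (induction rule: list_all2_induct) auto
  have le: "snd P + length (filter off_diagonal es) \<le> q" "snd P' + length (filter off_diagonal es') \<le> q"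
    using is_path_off_diagonal_le[of es "snd P" q m] is_path_off_diagonal_le[of es' "snd P'" q m] Cons.prems by auto
  have "P = P'" using le Cons.prems Cons.hyps(1) len
    by (cases "off_diagonal P") (auto simp: prod_eq_iff pairs_def)
  moreover have "es = es'"
    using Cons.prems le len \<open>P = P'\<close> by (intro Cons.IH[of "snd P"]) (auto simp: pairs_def split: if_splits)
  ultimately show ?case by simp
qed simp

section \<open>Multilinear words\<close>

text \<open>The words of \<open>multilinear_monomials\<close> with the permutation left implicit:
  the order of the indices along the word encodes it.\<close>

definition multilinear_words :: "'g set \<Rightarrow> nat \<Rightarrow> 'g indet list set" where
  "multilinear_words G n =
     {w. distinct (map index w) \<and> index ` set w = {1..n} \<and> degree ` set w \<subseteq> G}"

lemma length_multilinear_words: "w \<in> multilinear_words G n \<Longrightarrow> length w = n"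
  using distinct_card[of "map index w"] by (auto simp: multilinear_words_def)

lemma multilinear_monomials_eq:
  "(multilinear_monomials G n :: ('g indet list \<Rightarrow>\<^sub>0 'k::field) set) =
     (\<lambda>w. Poly_Mapping.single w 1) ` multilinear_words G n"
proof (intro equalityI subsetI)
  fix f :: "'g indet list \<Rightarrow>\<^sub>0 'k" assume "f \<in> multilinear_monomials G n"
  then obtain \<sigma> g \<delta> where f: "f = Poly_Mapping.single (map (\<lambda>k. Indet (\<sigma> k) (g k) (\<delta> k)) [1..<Suc n]) 1"
    and \<sigma>: "\<sigma> permutes {1..n}" and g: "\<forall>k\<in>{1..n}. g k \<in> G"
    by (auto simp: multilinear_monomials_def)
  let ?w = "map (\<lambda>k. Indet (\<sigma> k) (g k) (\<delta> k)) [1..<Suc n]"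
  have "map index ?w = map \<sigma> [1..<Suc n]" by simp
  then have "distinct (map index ?w)"
    using permutes_inj[OF \<sigma>] by (simp only: distinct_map) (auto intro: inj_on_subset)
  moreover have "index ` set ?w = \<sigma> ` {1..n}" by (auto simp: image_image atLeastLessThanSuc_atLeastAtMost)
  moreover have "\<sigma> ` {1..n} = {1..n}" by (rule permutes_image[OF \<sigma>])
  ultimately have "?w \<in> multilinear_words G n" using g by (auto simp: multilinear_words_def)
  then show "f \<in> (\<lambda>w. Poly_Mapping.single w 1) ` multilinear_words G n" using f by blast
next
  fix f :: "'g indet list \<Rightarrow>\<^sub>0 'k" assume "f \<in> (\<lambda>w. Poly_Mapping.single w 1) ` multilinear_words G n"
  then obtain w where f: "f = Poly_Mapping.single w 1" and w: "w \<in> multilinear_words G n" by auto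
  have len: "length w = n" using w by (rule length_multilinear_words)
  \<comment> \<open>Positions in the list start at 0, whereas the permutation acts on 1 to n. It
    must be the identity elsewhere.\<close>
  define \<sigma> where "\<sigma> k = (if k \<in> {1..n} then index (w ! (k - 1)) else k)" for k
  have "bij_betw \<sigma> {1..n} {1..n}"
  proof (rule bij_betw_imageI)
    show "inj_on \<sigma> {1..n}"
    proof (rule inj_onI)
      fix j k assume *: "j \<in> {1..n}" "k \<in> {1..n}" "\<sigma> j = \<sigma> k"
      have jk: "j - 1 < length w" "k - 1 < length w" using * len by auto
      from * have "map index w ! (j - 1) = map index w ! (k - 1)" using jk by (simp add: \<sigma>_def)
      moreover have "distinct (map index w)" using w by (simp add: multilinear_words_def)
      ultimately have "j - 1 = k - 1" using * len by (subst (asm) nth_eq_iff_index_eq) auto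
      then show "j = k" using * by auto
    qed
    have "\<sigma> ` {1..n} = (\<lambda>k. index (w ! k)) ` {..<n}"
    proof -
      have "{1..n} = Suc ` {..<n}" by (auto simp: image_iff) (metis Suc_le_D Suc_le_lessD lessThan_iff less_Suc_eq_le)
      then show ?thesis by (auto simp: \<sigma>_def image_image)
    qed
    also have "\<dots> = index ` set w" using len by (auto simp: set_conv_nth)
    finally show "\<sigma> ` {1..n} = {1..n}" using w by (simp add: multilinear_words_def)
  qed
  then have "\<sigma> permutes {1..n}" by (rule bij_imp_permutes) (auto simp: \<sigma>_def)
  moreover have "w = map (\<lambda>k. Indet (\<sigma> k) (degree (w ! (k - 1))) (starred (w ! (k - 1)))) [1..<Suc n]"
    using len by (intro nth_equalityI) (auto simp: \<sigma>_def simp del: upt_Suc)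
  moreover have "\<forall>k\<in>{1..n}. degree (w ! (k - 1)) \<in> G"
    using w len nth_mem[of "_ - 1" w] by (auto simp: multilinear_words_def intro!: subsetD[of "degree ` set w" G])
  ultimately show "f \<in> multilinear_monomials G n"
    unfolding multilinear_monomials_def f by (intro CollectI exI conjI) (rule arg_cong[where f = "\<lambda>w. Poly_Mapping.single w 1"])
qed

text \<open>Each index occurs in exactly one letter, so counting along the word equals counting
  indices. This transfers facts about the path of a word to facts about \<open>b\<close>.\<close>

lemma count_multilinear_word:
  assumes "w \<in> multilinear_words G n" "\<And>x. x \<in> set w \<Longrightarrow> Q (f x) \<longleftrightarrow> R (index x)"
  shows "length (filter Q (map f w)) = card {i \<in> {1..n}. R i}"
proof -
  have "length (filter Q (map f w)) = length (filter (\<lambda>x. Q (f x)) w)" by (simp add: filter_map o_def)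
  also have "filter (\<lambda>x. Q (f x)) w = filter (\<lambda>x. R (index x)) w" using assms(2) by (intro filter_cong) auto
  also have "length \<dots> = length (filter R (map index w))" by (simp add: filter_map o_def)
  also have "\<dots> = card (set (filter R (map index w)))"
    using assms(1) by (intro distinct_card[symmetric] distinct_filter) (auto simp: multilinear_words_def)
  also have "set (filter R (map index w)) = {i \<in> {1..n}. R i}"
    using assms(1) by (auto simp: multilinear_words_def)
  finally show ?thesis .
qed

section \<open>Paths with the maximal number of steps\<close>

definition diagonal :: "nat \<Rightarrow> (nat \<times> nat) set" where
  "diagonal m = (\<lambda>k. (k, k)) ` {..<m}"

text \<open>A step \<open>(k, k + 1)\<close> and its mirror image have the same degree. They coincide when \<open>j = r - 1\<close>.\<close>

definition step_class :: "nat \<Rightarrow> nat \<Rightarrow> (nat \<times> nat) set" where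
  "step_class r j = {(j, Suc j), (2 * r - 2 - j, 2 * r - 1 - j)}"

text \<open>A path through all steps takes each member of a class once, so this is both the size of
  the class and the number of indices sent into it.\<close>

definition step_mult :: "nat \<Rightarrow> nat \<Rightarrow> nat" where
  "step_mult r j = (if Suc j = r then 1 else 2)"

definition full_colourings :: "nat \<Rightarrow> nat \<Rightarrow> (nat \<Rightarrow> nat \<times> nat) set" where
  "full_colourings r n = colourings {1..n} (diagonal (2 * r)) (step_class r) (step_mult r) r"

lemma step_class_eq: "j < r \<Longrightarrow> step_class r j = (\<lambda>k. (k, Suc k)) ` {j, 2 * r - 2 - j}"
  by (auto simp: step_class_def)

lemma step_class_mirror_iff:
  assumes "j < r" "P \<in> pairs (2 * r)"
  shows "mirror (2 * r) P \<in> step_class r j \<longleftrightarrow> P \<in> step_class r j"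
proof -
  obtain k l where P: "P = (k, l)" by (cases P)
  have "k \<le> l" "l < 2 * r" using assms by (auto simp: P pairs_def)
  then show ?thesis using assms(1) by (auto simp: P mirror_def step_class_def)
qed

lemma step_class_cases:
  assumes "j < r" "P \<in> step_class r j" "Q \<in> step_class r j"
  shows "Q = P \<or> Q = mirror (2 * r) P"
  using assms by (auto simp: step_class_def mirror_def)

lemma step_class_off_diagonal: "j < r \<Longrightarrow> P \<in> step_class r j \<Longrightarrow> off_diagonal P"
  by (auto simp: step_class_def)

lemma step_class_pairs: "j < r \<Longrightarrow> step_class r j \<subseteq> pairs (2 * r)"
  by (auto simp: step_class_def pairs_def)

lemma off_diagonal_mirror: "P \<in> pairs m \<Longrightarrow> off_diagonal (mirror m P) \<longleftrightarrow> off_diagonal P"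
  by (auto simp: mirror_def pairs_def)

text \<open>The lower of two mirrored steps gives the class its number, hence the minimum.\<close>

lemma step_in_class:
  assumes "k < 2 * r - 1"
  shows "(k, Suc k) \<in> step_class r (min k (2 * r - 2 - k)) \<and> min k (2 * r - 2 - k) < r"
  using assms by (auto simp: step_class_def min_def)

lemma step_class_disjoint: "i < j \<Longrightarrow> j < r \<Longrightarrow> step_class r i \<inter> step_class r j = {}"
  by (auto simp: step_class_def)

lemma card_step_class: "j < r \<Longrightarrow> card (step_class r j) = step_mult r j"
  by (auto simp: step_class_def step_mult_def card_insert_if)

text \<open>The number of off-diagonal edges is at least 2r - 1 and at most q - p, which is at most
  2r - 1. All are equal, so the path is tight and takes every step once. Classes are closed under
  mirroring, so counting edges in a class counts the values of \<open>b\<close> in it.\<close>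

lemma full_colouring_of_path:
  assumes "r \<ge> 1" and w: "w \<in> multilinear_words G n" and pq: "p < 2 * r" "q < 2 * r"
    and nz: "word_entry (2 * r) (basis_letter r b) w p q \<noteq> (0 :: 'k::field)"
    and b: "b \<in> {1..n} \<rightarrow>\<^sub>E pairs (2 * r)"
    and off: "2 * r - 1 \<le> card {i \<in> {1..n}. off_diagonal (b i)}"
  shows "p = 0 \<and> q = 2 * r - 1 \<and> b \<in> full_colourings r n"
proof -
  let ?es = "map (edge r b) w"
  have path: "is_path ?es p q" and bp: "\<And>x. x \<in> set w \<Longrightarrow> b (index x) \<in> pairs (2 * r)"
    using nz word_entry_nonzero_iff[OF pq, where 'k = 'k] by auto
  have sub: "set ?es \<subseteq> pairs (2 * r)" unfolding set_map using bp by (intro image_subsetI edge_pairs)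
  have "length (filter off_diagonal ?es) = card {i \<in> {1..n}. off_diagonal (b i)}"
    using bp off_diagonal_mirror by (intro count_multilinear_word[OF w]) (auto simp: edge_def)
  moreover have "p + length (filter off_diagonal ?es) \<le> q" by (rule is_path_off_diagonal_le[OF path sub])
  ultimately have p: "p = 0" and q: "q = 2 * r - 1" and len: "length (filter off_diagonal ?es) = 2 * r - 1"
    using off pq by linarith+
  have steps: "filter off_diagonal ?es = map (\<lambda>k. (k, Suc k)) [0..<2 * r - 1]"
    using is_path_tight[OF path sub] p q len by simp
  have "b i \<in> diagonal (2 * r) \<union> (\<Union>j<r. step_class r j)" if i: "i \<in> {1..n}" for i
  proof (cases "off_diagonal (b i)")
    case True
    have "i \<in> index ` set w" using w i by (simp add: multilinear_words_def)
    then obtain x where x: "x \<in> set w" "i = index x" by blast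
    have "edge r b x \<in> set (filter off_diagonal ?es)"
      using x True off_diagonal_mirror[OF bp[OF x(1)]] by (auto simp: edge_def)
    then obtain k where k: "k < 2 * r - 1" "edge r b x = (k, Suc k)" unfolding steps by auto
    let ?j = "min k (2 * r - 2 - k)"
    have "edge r b x \<in> step_class r ?j" "?j < r" using step_in_class[OF k(1)] k(2) by auto
    then have "b i \<in> step_class r ?j"
      using step_class_mirror_iff[OF _ bp[OF x(1)]] x by (auto simp: edge_def split: if_splits)
    then show ?thesis using \<open>?j < r\<close> by blast
  next
    case False
    then show ?thesis using PiE_mem[OF b i] by (cases "b i") (auto simp: diagonal_def pairs_def)
  qed
  then have "b \<in> {1..n} \<rightarrow>\<^sub>E diagonal (2 * r) \<union> (\<Union>j<r. step_class r j)"
    using b by (auto simp: PiE_def)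
  moreover have "card {i \<in> {1..n}. b i \<in> step_class r j} = step_mult r j" if j: "j < r" for j
  proof -
    have "card {i \<in> {1..n}. b i \<in> step_class r j} = length (filter (\<lambda>P. P \<in> step_class r j) ?es)"
      using bp step_class_mirror_iff[OF j]
      by (intro count_multilinear_word[OF w, symmetric]) (auto simp: edge_def)
    also have "filter (\<lambda>P. P \<in> step_class r j) ?es = filter (\<lambda>P. P \<in> step_class r j) (filter off_diagonal ?es)"
      unfolding filter_filter using step_class_off_diagonal[OF j] by (intro filter_cong) auto
    also have "length \<dots> = length (filter (\<lambda>k. (k, Suc k) \<in> step_class r j) [0..<2 * r - 1])"
      unfolding steps by (simp add: filter_map o_def)
    also have "\<dots> = card (set (filter (\<lambda>k. (k, Suc k) \<in> step_class r j) [0..<2 * r - 1]))"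
      by (rule distinct_card[symmetric]) simp
    also have "set (filter (\<lambda>k. (k, Suc k) \<in> step_class r j) [0..<2 * r - 1]) = {j, 2 * r - 2 - j}"
      using j by (auto simp: step_class_def)
    also have "card \<dots> = step_mult r j" using j by (auto simp: step_mult_def card_insert_if)
    finally show ?thesis .
  qed
  ultimately show ?thesis using p q by (simp add: full_colourings_def colourings_def)
qed

lemma is_path_append_loops:
  "(\<And>y. y \<in> set ys \<Longrightarrow> e y = (p, p)) \<Longrightarrow> is_path (map e ys @ es) p q \<longleftrightarrow> is_path es p q"
  by (induction ys) auto

text \<open>List the loops at p, then the unique step that leaves p. What remains satisfies the
  hypotheses from p + 1 on.\<close>

lemma ex_path_through:
  assumes "finite I" "p \<le> q" "\<And>i. i \<in> I \<Longrightarrow> (\<exists>k\<in>{p..q}. e i = (k, k)) \<or> (\<exists>k\<in>{p..<q}. e i = (k, Suc k))"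
    and "\<And>k. k \<in> {p..<q} \<Longrightarrow> \<exists>!i. i \<in> I \<and> e i = (k, Suc k)"
  shows "\<exists>xs. distinct xs \<and> set xs = I \<and> is_path (map e xs) p q"
  using assms(2,1,3,4)
proof (induction p arbitrary: I rule: inc_induct)
  case base
  obtain xs where xs: "set xs = I" "distinct xs" using finite_distinct_list[OF base.prems(1)] by blast
  then have "e x = (q, q)" if "x \<in> set xs" for x using base.prems(2)[of x] that by auto
  then have "is_path (map e xs @ []) q q \<longleftrightarrow> is_path [] q q" by (rule is_path_append_loops)
  then show ?case using xs by auto
next
  case (step p)
  let ?L = "{i \<in> I. e i = (p, p)}"
  obtain i where i: "i \<in> I" "e i = (p, Suc p)" "\<And>j. j \<in> I \<Longrightarrow> e j = (p, Suc p) \<Longrightarrow> j = i"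
  proof -
    have "\<exists>!i. i \<in> I \<and> e i = (p, Suc p)" using step.hyps by (intro step.prems(3)) simp
    then show ?thesis using that unfolding Ex1_def by blast
  qed
  let ?I = "I - insert i ?L"
  have "\<exists>xs. distinct xs \<and> set xs = ?I \<and> is_path (map e xs) (Suc p) q"
  proof (rule step.IH)
    show "finite ?I" using step.prems by auto
    fix j assume j: "j \<in> ?I"
    then have ne: "e j \<noteq> (p, p)" "e j \<noteq> (p, Suc p)" using i(3)[of j] by blast+
    have "j \<in> I" using j by simp
    from step.prems(2)[OF this]
    show "(\<exists>k\<in>{Suc p..q}. e j = (k, k)) \<or> (\<exists>k\<in>{Suc p..<q}. e j = (k, Suc k))"
    proof (elim disjE bexE)
      fix k assume "k \<in> {p..q}" "e j = (k, k)"
      moreover from this have "k \<noteq> p" using ne by metis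
      ultimately show ?thesis by (intro disjI1 bexI[of _ k]) auto
    next
      fix k assume "k \<in> {p..<q}" "e j = (k, Suc k)"
      moreover from this have "k \<noteq> p" using ne by metis
      ultimately show ?thesis by (intro disjI2 bexI[of _ k]) auto
    qed
  next
    fix k assume k: "k \<in> {Suc p..<q}"
    then have "\<exists>!j. j \<in> I \<and> e j = (k, Suc k)" by (intro step.prems(3)) simp
    moreover have "j \<in> ?I \<and> e j = (k, Suc k) \<longleftrightarrow> j \<in> I \<and> e j = (k, Suc k)" for j using k i(2) by auto
    ultimately show "\<exists>!j. j \<in> ?I \<and> e j = (k, Suc k)" by presburger
  qed
  then obtain xs where xs: "distinct xs" "set xs = ?I" "is_path (map e xs) (Suc p) q" by blast
  obtain ys where ys: "set ys = ?L" "distinct ys" using finite_distinct_list[of ?L] step.prems(1) by auto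
  have "is_path (map e ys @ map e (i # xs)) p q \<longleftrightarrow> is_path (map e (i # xs)) p q"
    using ys by (intro is_path_append_loops) auto
  then have "is_path (map e (ys @ i # xs)) p q" using xs(3) i(2) by simp
  moreover have "distinct (ys @ i # xs)" using xs ys i(2) by auto
  moreover have "set (ys @ i # xs) = I" using xs ys i(1) by auto
  ultimately show ?case by blast
qed

text \<open>In each noncentral class two indices have to take the two steps once each, but
  \<open>b\<close> may send both to the same step. One index is designated for the lower step and
  the other for the upper one, and a star corrects each letter whose unit is at the wrong
  step.\<close>

lemma ex_word_of_full_colouring:
  assumes "r \<ge> 1" and b: "b \<in> full_colourings r n"
  shows "\<exists>w\<in>multilinear_words (carrier_vec r) n. word_entry (2 * r) (basis_letter r b) w 0 (2 * r - 1) \<noteq> (0 :: 'k::field)"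
proof -
  define S where "S j = {i \<in> {1..n}. b i \<in> step_class r j}" for j
  have card_S: "card (S j) = step_mult r j" if "j < r" for j
    using b that by (auto simp: S_def full_colourings_def colourings_def)
  have bi: "b i \<in> diagonal (2 * r) \<union> (\<Union>j<r. step_class r j)" if "i \<in> {1..n}" for i
  proof -
    have "b \<in> {1..n} \<rightarrow>\<^sub>E diagonal (2 * r) \<union> (\<Union>j<r. step_class r j)"
      using b by (simp add: full_colourings_def colourings_def)
    from PiE_mem[OF this that] show ?thesis .
  qed
  have pairs_b: "b i \<in> pairs (2 * r)" if i: "i \<in> {1..n}" for i
  proof (cases "b i \<in> diagonal (2 * r)")
    case False
    then obtain j where "j < r" "b i \<in> step_class r j" using bi[OF i] by blast
    then show ?thesis using step_class_pairs by blast
  qed (auto simp: diagonal_def pairs_def)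
  \<comment> \<open>The index designated for the lower step of class j, chosen arbitrarily among the
    one or two available.\<close>
  define f where "f j = (SOME i. i \<in> S j)" for j
  have f: "f j \<in> S j" if "j < r" for j
  proof -
    have "card (S j) \<noteq> 0" using card_S[OF that] by (simp add: step_mult_def)
    then have "S j \<noteq> {}" by force
    then show ?thesis by (simp add: f_def some_in_eq)
  qed
  \<comment> \<open>The number of the class of \<open>b i\<close>. For diagonal values it has no
    meaning, and \<open>e\<close> does not use it there.\<close>
  define c where "c i = min (fst (b i)) (2 * r - 2 - fst (b i))" for i
  define e where "e i = (if off_diagonal (b i) then
      (if i = f (c i) then (c i, Suc (c i)) else (2 * r - 2 - c i, 2 * r - 1 - c i)) else b i)" for i
  have c: "c i = j" if "i \<in> S j" "j < r" for i j
  proof -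
    have "fst (b i) = j \<or> fst (b i) = 2 * r - 2 - j" using that(1) by (auto simp: S_def step_class_def)
    then show ?thesis using that(2) unfolding c_def by linarith
  qed
  have off: "\<exists>j<r. i \<in> S j \<and> c i = j" if i: "i \<in> {1..n}" "off_diagonal (b i)" for i
  proof -
    have "b i \<notin> diagonal (2 * r)" using i(2) by (auto simp: diagonal_def)
    then obtain j where j: "j < r" "b i \<in> step_class r j" using bi[OF i(1)] by blast
    then have "i \<in> S j" using i(1) by (simp add: S_def)
    then show ?thesis using c[OF _ j(1)] j(1) by blast
  qed
  have e_S: "e i = (if i = f j then (j, Suc j) else (2 * r - 2 - j, 2 * r - 1 - j))" "e i \<in> step_class r j"
    if "i \<in> S j" "j < r" for i j
  proof -
    have "off_diagonal (b i)" using that step_class_off_diagonal by (simp add: S_def)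
    then show "e i = (if i = f j then (j, Suc j) else (2 * r - 2 - j, 2 * r - 1 - j))"
      using c[OF that] by (cases "i = f j") (simp_all add: e_def)
    then show "e i \<in> step_class r j" by (simp add: step_class_def)
  qed
  have e_cases: "e i = b i \<or> e i = mirror (2 * r) (b i)" if i: "i \<in> {1..n}" for i
  proof (cases "off_diagonal (b i)")
    case True
    then obtain j where j: "j < r" "i \<in> S j" using off[OF i] by auto
    then have "b i \<in> step_class r j" by (auto simp: S_def)
    then show ?thesis using step_class_cases[OF j(1) _ e_S(2)[OF j(2,1)]] by blast
  qed (simp add: e_def)
  have step_S: "i \<in> S (min k (2 * r - 2 - k))" if i: "i \<in> {1..n}" "e i = (k, Suc k)" "k < 2 * r - 1" for i k
  proof -
    have "off_diagonal (b i)" using i by (auto simp: e_def)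
    then obtain j where j: "j < r" "i \<in> S j" using off[OF i(1)] by auto
    have "k = j \<or> k = 2 * r - 2 - j"
      using e_S(2)[OF j(2,1)] unfolding i(2) by (auto simp: step_class_def)
    then have "min k (2 * r - 2 - k) = j" using j(1) by linarith
    then show ?thesis using j(2) by (simp only:)
  qed
  have "\<exists>xs. distinct xs \<and> set xs = {1..n} \<and> is_path (map e xs) 0 (2 * r - 1)"
  proof (rule ex_path_through)
    fix i assume i: "i \<in> {1..n}"
    show "(\<exists>k\<in>{0..2 * r - 1}. e i = (k, k)) \<or> (\<exists>k\<in>{0..<2 * r - 1}. e i = (k, Suc k))"
    proof (cases "off_diagonal (b i)")
      case True
      then obtain j where j: "j < r" "i \<in> S j" using off i by auto
      have "e i \<in> (\<lambda>k. (k, Suc k)) ` {j, 2 * r - 2 - j}"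
        using e_S(2)[OF j(2,1)] step_class_eq[OF j(1)] by simp
      moreover have "{j, 2 * r - 2 - j} \<subseteq> {0..<2 * r - 1}" using j(1) by auto
      ultimately show ?thesis by blast
    next
      case False
      then have "e i = (fst (b i), fst (b i))" by (auto simp: e_def prod_eq_iff)
      then show ?thesis using pairs_bounds[OF pairs_b[OF i]] by auto
    qed
  next
    fix k assume "k \<in> {0..<2 * r - 1}"
    then have k: "k < 2 * r - 1" by simp
    define j where "j = min k (2 * r - 2 - k)"
    have j: "j < r" using k by (auto simp: j_def)
    have fj: "f j \<in> S j" by (rule f[OF j])
    have fin: "finite (S j)" by (simp add: S_def)
    have in_S: "i \<in> S j" if "i \<in> {1..n}" "e i = (k, Suc k)" for i
      using step_S[OF that k] by (simp add: j_def)
    show "\<exists>!i. i \<in> {1..n} \<and> e i = (k, Suc k)"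
    proof (cases "k = j")
      case True
      \<comment> \<open>Another index of the class would take the upper step. That equals the lower
        step only in the central class, which has a single index.\<close>
      have "i = f j" if "i \<in> {1..n}" "e i = (k, Suc k)" for i
      proof (rule ccontr)
        assume ne: "i \<noteq> f j"
        have "2 * r - 2 - j = k" using e_S(1)[OF in_S[OF that] j] ne that(2) by simp
        then have "Suc j = r" using True j by linarith
        then have "card (S j) = 1" using card_S[OF j] by (simp add: step_mult_def)
        then show False using in_S[OF that] fj ne by (auto simp: card_1_singleton_iff)
      qed
      moreover have "e (f j) = (k, Suc k)" using e_S(1)[OF fj j] True by simp
      moreover have "f j \<in> {1..n}" using fj by (simp add: S_def)
      ultimately show ?thesis by blast
    next
      case False
      then have kj: "k = 2 * r - 2 - j" "Suc j \<noteq> r" using k by (auto simp: j_def min_def split: if_splits)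
      then have "card (S j - {f j}) = 1" using card_S[OF j] fj fin by (simp add: step_mult_def)
      then obtain i where i: "S j - {f j} = {i}" by (auto simp: card_1_singleton_iff)
      then have "i \<in> S j" "i \<noteq> f j" by auto
      then have "e i = (k, Suc k)" using e_S(1)[of i j] j kj k by auto
      moreover have "i' = i" if "i' \<in> {1..n}" "e i' = (k, Suc k)" for i'
      proof -
        have "i' \<noteq> f j" using e_S(1)[OF fj j] that False by auto
        then show ?thesis using in_S[OF that] i by auto
      qed
      moreover have "i \<in> {1..n}" using \<open>i \<in> S j\<close> by (simp add: S_def)
      ultimately show ?thesis by blast
    qed
  qed auto
  then obtain xs where xs: "distinct xs" "set xs = {1..n}" "is_path (map e xs) 0 (2 * r - 1)" by blast
  \<comment> \<open>The star is set exactly where the intended edge differs from the unit of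
    \<open>b\<close>; by \<open>e_cases\<close> the edge is then its mirror image.\<close>
  define w where "w = map (\<lambda>i. Indet i (pair_degree r (b i)) (e i \<noteq> b i)) xs"
  have "map (edge r b) w = map e xs" unfolding w_def map_map
  proof (rule map_cong[OF refl])
    fix i assume "i \<in> set xs"
    then have "e i = b i \<or> e i = mirror (2 * r) (b i)" using e_cases xs(2) by blast
    then show "(edge r b \<circ> (\<lambda>i. Indet i (pair_degree r (b i)) (e i \<noteq> b i))) i = e i"
      unfolding edge_def o_apply indet.sel by (metis (full_types))
  qed
  then have path: "is_path (map (edge r b) w) 0 (2 * r - 1)" using xs(3) by (simp only:)
  have index: "map index w = xs" unfolding w_def by (simp add: o_def)
  have "distinct (map index w)" unfolding index by (rule xs(1))
  moreover have "index ` set w = {1..n}" using xs(2) unfolding index[symmetric] by simp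
  moreover have "degree ` set w \<subseteq> carrier_vec r" unfolding w_def set_map image_image indet.sel
    by (intro image_subsetI carrier_vecI) (simp add: pair_degree_def)
  ultimately have "w \<in> multilinear_words (carrier_vec r) n" unfolding multilinear_words_def by blast
  moreover have "\<forall>x\<in>set w. b (index x) \<in> pairs (2 * r) \<and> pair_degree r (b (index x)) = degree x"
    unfolding w_def set_map using pairs_b xs(2) by simp
  then have "word_entry (2 * r) (basis_letter r b) w 0 (2 * r - 1) \<noteq> (0 :: 'k)"
    using path assms(1) by (intro iffD2[OF word_entry_nonzero_iff] conjI) simp_all
  ultimately show ?thesis by blast
qed

text \<open>The degrees in \<open>w\<close> impose the same pattern of loops and steps on both
  paths. The first path is tight, so \<open>is_path_tight_unique\<close> identifies the edges, and
  undoing the stars identifies the maps.\<close>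

lemma full_colouring_unique:
  assumes "r \<ge> 1" and w: "w \<in> multilinear_words G n"
    and b: "b \<in> full_colourings r n" "word_entry (2 * r) (basis_letter r b) w 0 (2 * r - 1) \<noteq> (0 :: 'k::field)"
    and b': "b' \<in> full_colourings r n" "word_entry (2 * r) (basis_letter r b') w 0 (2 * r - 1) \<noteq> (0 :: 'k::field)"
    and card: "card {i \<in> {1..n}. off_diagonal (b i)} = 2 * r - 1"
  shows "b = b'"
proof -
  have lt: "0 < 2 * r" "2 * r - 1 < 2 * r" using assms(1) by auto
  have 1: "is_path (map (edge r b) w) 0 (2 * r - 1)"
    "\<And>x. x \<in> set w \<Longrightarrow> b (index x) \<in> pairs (2 * r) \<and> pair_degree r (b (index x)) = degree x"
    using b(2) word_entry_nonzero_iff[OF lt, where 'k = 'k] by auto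
  have 2: "is_path (map (edge r b') w) 0 (2 * r - 1)"
    "\<And>x. x \<in> set w \<Longrightarrow> b' (index x) \<in> pairs (2 * r) \<and> pair_degree r (b' (index x)) = degree x"
    using b'(2) word_entry_nonzero_iff[OF lt, where 'k = 'k] by auto
  have sub: "set (map (edge r b) w) \<subseteq> pairs (2 * r)" "set (map (edge r b') w) \<subseteq> pairs (2 * r)"
    unfolding set_map using 1 2 by (intro image_subsetI edge_pairs; simp)+
  have off: "off_diagonal (edge r c x) \<longleftrightarrow> off_diagonal (c (index x))"
    if "c (index x) \<in> pairs (2 * r)" for c and x :: "int vec indet"
    using off_diagonal_mirror[OF that] by (auto simp: edge_def)
  have "length (filter off_diagonal (map (edge r b) w)) = card {i \<in> {1..n}. off_diagonal (b i)}"
    using 1 off by (intro count_multilinear_word[OF w]) auto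
  then have len: "2 * r - 1 = 0 + length (filter off_diagonal (map (edge r b) w))" using card by simp
  have same: "off_diagonal (edge r b x) \<longleftrightarrow> off_diagonal (edge r b' x)" if "x \<in> set w" for x
  proof -
    \<comment> \<open>The right-hand side does not involve \<open>c\<close>, so the pattern is a
      property of the word alone.\<close>
    have eq: "off_diagonal (edge r c x) = (degree x \<noteq> 0\<^sub>v r)"
      if c: "c (index x) \<in> pairs (2 * r)" "pair_degree r (c (index x)) = degree x" for c
      unfolding off[where c = c, OF c(1)] c(2)[symmetric] pair_degree_eq_zero_iff[OF c(1)] ..
    have "off_diagonal (edge r b x) = (degree x \<noteq> 0\<^sub>v r)"
      by (rule eq) (use 1(2)[OF that] in simp_all)
    moreover have "off_diagonal (edge r b' x) = (degree x \<noteq> 0\<^sub>v r)"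
      by (rule eq) (use 2(2)[OF that] in simp_all)
    ultimately show ?thesis by (simp only:)
  qed
  have pattern: "list_all2 (\<lambda>P P'. off_diagonal P \<longleftrightarrow> off_diagonal P') (map (edge r b) w) (map (edge r b') w)"
    by (rule list_all2_all_nthI) (simp_all add: same)
  have "map (edge r b) w = map (edge r b') w"
    by (rule is_path_tight_unique[OF 1(1) sub(1) len 2(1) sub(2) pattern])
  then have edge: "edge r b x = edge r b' x" if "x \<in> set w" for x
    unfolding map_eq_conv using that by (rule bspec)
  have eq: "b (index x) = b' (index x)" if "x \<in> set w" for x
  proof (cases "starred x")
    case True
    have "mirror (2 * r) (mirror (2 * r) (c (index x))) = c (index x)" if "c (index x) \<in> pairs (2 * r)" for c
      using pairs_bounds[OF that] by (intro mirror_mirror) auto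
    then show ?thesis using edge[OF that] 1(2)[OF that] 2(2)[OF that] True by (metis edge_def)
  qed (use edge[OF that] in \<open>simp add: edge_def\<close>)
  have ext: "b \<in> extensional {1..n}" "b' \<in> extensional {1..n}"
    using b(1) b'(1) unfolding full_colourings_def colourings_def PiE_def by blast+
  show "b = b'"
  proof (rule extensionalityI[OF ext])
    fix i assume "i \<in> {1..n}"
    then have "i \<in> index ` set w" using w by (simp add: multilinear_words_def)
    then show "b i = b' i" using eq by blast
  qed
qed

section \<open>The identities as a common kernel\<close>

lemma lookup_scale [simp]: "Poly_Mapping.lookup (Poly_Mapping.map ((*) c) p) w = (c::'k::field) * Poly_Mapping.lookup p w"
  by (simp add: Poly_Mapping.map.rep_eq when_def)

lemma keys_scale: "Poly_Mapping.keys (Poly_Mapping.map ((*) (c::'k::field)) p) \<subseteq> Poly_Mapping.keys p"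
  by (auto simp: in_keys_iff)

lemma free_alg_simps:
  "carrier (free_alg G) = {p. Poly_Mapping.keys p \<subseteq> lists {x. degree x \<in> G}}"
  "zero (free_alg G) = 0" "add (free_alg G) = (+)" "smult (free_alg G) = (\<lambda>c. Poly_Mapping.map ((*) c))"
  by (simp_all add: free_alg_def)

lemma scale_laws:
  fixes c :: "'k::field"
  shows "Poly_Mapping.map ((*) c) (p + q) = Poly_Mapping.map ((*) c) p + Poly_Mapping.map ((*) c) q"
    and "Poly_Mapping.map ((*) (c + d)) p = Poly_Mapping.map ((*) c) p + Poly_Mapping.map ((*) d) p"
    and "Poly_Mapping.map ((*) (c * d)) p = Poly_Mapping.map ((*) c) (Poly_Mapping.map ((*) d) p)"
    and "Poly_Mapping.map ((*) 1) p = (p :: 'w \<Rightarrow>\<^sub>0 'k)"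
  by (rule poly_mapping_eqI, simp add: lookup_add distrib_left distrib_right mult.assoc)+

lemma vectorspace_free_alg:
  "vectorspace class_ring (free_alg G :: ('k::field, 'g indet list \<Rightarrow>\<^sub>0 'k) module)"
proof (rule vs_criteria)
  show "field (class_ring :: 'k ring)" by (rule class_field)
  show "\<forall>v\<in>carrier (free_alg G). \<exists>n\<in>carrier (free_alg G). v \<oplus>\<^bsub>free_alg G\<^esub> n = \<zero>\<^bsub>free_alg G :: ('k, 'g indet list \<Rightarrow>\<^sub>0 'k) module\<^esub>"
  proof
    fix v :: "'g indet list \<Rightarrow>\<^sub>0 'k" assume "v \<in> carrier (free_alg G)"
    then show "\<exists>n\<in>carrier (free_alg G). v \<oplus>\<^bsub>free_alg G\<^esub> n = \<zero>\<^bsub>free_alg G :: ('k, 'g indet list \<Rightarrow>\<^sub>0 'k) module\<^esub>"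
      by (intro bexI[of _ "- v"]) (auto simp: free_alg_simps)
  qed
  show "\<forall>v w. v \<in> carrier (free_alg G) \<and> w \<in> carrier (free_alg G) \<longrightarrow>
      v \<oplus>\<^bsub>free_alg G :: ('k, 'g indet list \<Rightarrow>\<^sub>0 'k) module\<^esub> w \<in> carrier (free_alg G)"
    by (simp add: free_alg_simps subset_trans[OF Poly_Mapping.keys_add])
  show "\<forall>c v. c \<in> carrier class_ring \<and> v \<in> carrier (free_alg G) \<longrightarrow>
      c \<odot>\<^bsub>free_alg G :: ('k, 'g indet list \<Rightarrow>\<^sub>0 'k) module\<^esub> v \<in> carrier (free_alg G)"
    by (simp add: free_alg_simps subset_trans[OF keys_scale])
qed (simp_all add: free_alg_simps scale_laws add.commute add.assoc)

text \<open>Linear extension of \<open>h\<close> from words to polynomials. Under a graded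
  substitution every matrix entry of \<open>poly_val\<close> has this form.\<close>

definition eval_sum :: "('w \<Rightarrow> 'k::field) \<Rightarrow> ('w \<Rightarrow>\<^sub>0 'k) \<Rightarrow> 'k" where
  "eval_sum h p = (\<Sum>w\<in>Poly_Mapping.keys p. Poly_Mapping.lookup p w * h w)"

lemma eval_sum_superset:
  "finite K \<Longrightarrow> Poly_Mapping.keys p \<subseteq> K \<Longrightarrow> eval_sum h p = (\<Sum>w\<in>K. Poly_Mapping.lookup p w * h w)"
  unfolding eval_sum_def by (rule sum.mono_neutral_left) (auto simp: in_keys_iff)

lemma eval_sum_add: "eval_sum h (p + q) = eval_sum h p + eval_sum h q"
proof -
  let ?K = "Poly_Mapping.keys p \<union> Poly_Mapping.keys q"
  have "eval_sum h (p + q) = (\<Sum>w\<in>?K. Poly_Mapping.lookup (p + q) w * h w)"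
    by (rule eval_sum_superset[OF _ Poly_Mapping.keys_add]) simp
  then show ?thesis
    by (simp add: lookup_add distrib_right sum.distrib eval_sum_superset[of ?K])
qed

lemma eval_sum_scale: "eval_sum h (Poly_Mapping.map ((*) c) p) = c * eval_sum h p"
  by (subst eval_sum_superset[OF finite_keys keys_scale])
    (simp add: eval_sum_def sum_distrib_left mult.assoc)

lemma eval_sum_single [simp]: "eval_sum h (Poly_Mapping.single w 1) = h w"
  by (simp add: eval_sum_def)

lemma multilinear_words_subset: "multilinear_words G n \<subseteq> lists {x. degree x \<in> G}"
  by (auto simp: multilinear_words_def)

lemma multilinear_monomials_carrier:
  "(multilinear_monomials G n :: ('g indet list \<Rightarrow>\<^sub>0 'k::field) set) \<subseteq> carrier (free_alg G)"
  unfolding multilinear_monomials_eq free_alg_simps using multilinear_words_subset[of G n] by auto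

lemma submodule_multilinear_polys:
  "submodule class_ring (multilinear_polys G n) (free_alg G :: ('k::field, 'g indet list \<Rightarrow>\<^sub>0 'k) module)"
proof -
  interpret vectorspace class_ring "free_alg G :: ('k, 'g indet list \<Rightarrow>\<^sub>0 'k) module"
    by (rule vectorspace_free_alg)
  show ?thesis unfolding multilinear_polys_def
    by (rule span_is_submodule[OF multilinear_monomials_carrier])
qed

lemma single_in_multilinear_polys:
  assumes "w \<in> multilinear_words G n"
  shows "Poly_Mapping.single w 1 \<in> (multilinear_polys G n :: ('g indet list \<Rightarrow>\<^sub>0 'k::field) set)"
proof -
  interpret vectorspace class_ring "free_alg G :: ('k, 'g indet list \<Rightarrow>\<^sub>0 'k) module"
    by (rule vectorspace_free_alg)
  show ?thesis unfolding multilinear_polys_def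
    by (rule subsetD[OF in_own_span[OF multilinear_monomials_carrier]])
      (use assms in \<open>simp add: multilinear_monomials_eq\<close>)
qed

text \<open>Polynomials supported on multilinear words form a subspace that contains the spanning
  monomials.\<close>

lemma keys_multilinear_polys:
  assumes "p \<in> (multilinear_polys G n :: ('g indet list \<Rightarrow>\<^sub>0 'k::field) set)"
  shows "Poly_Mapping.keys p \<subseteq> multilinear_words G n"
proof -
  interpret vectorspace class_ring "free_alg G :: ('k, 'g indet list \<Rightarrow>\<^sub>0 'k) module"
    by (rule vectorspace_free_alg)
  let ?U = "{p. Poly_Mapping.keys p \<subseteq> multilinear_words G n} :: ('g indet list \<Rightarrow>\<^sub>0 'k) set"
  have "submodule class_ring ?U (free_alg G)"
  proof (rule submodule.intro)
    show "module class_ring (free_alg G :: ('k, 'g indet list \<Rightarrow>\<^sub>0 'k) module)" by (rule module_axioms)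
    show "?U \<subseteq> carrier (free_alg G)"
      using multilinear_words_subset[of G n] by (auto simp: free_alg_simps)
    show "v \<oplus>\<^bsub>free_alg G\<^esub> w \<in> ?U" if "v \<in> ?U" "w \<in> ?U" for v w
      using that by (simp add: free_alg_simps subset_trans[OF Poly_Mapping.keys_add])
    show "c \<odot>\<^bsub>free_alg G\<^esub> v \<in> ?U" if "v \<in> ?U" for c v
      using that by (simp add: free_alg_simps subset_trans[OF keys_scale])
  qed (simp add: free_alg_simps)
  moreover have "multilinear_monomials G n \<subseteq> ?U" by (auto simp: multilinear_monomials_eq)
  ultimately have "span (multilinear_monomials G n) \<subseteq> ?U" by (intro span_is_subset)
  then show ?thesis using assms unfolding multilinear_polys_def by blast
qed

lemma poly_val_index:
  fixes a :: "nat \<Rightarrow> int vec \<Rightarrow> 'k::field mat"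
  assumes keys: "Poly_Mapping.keys p \<subseteq> lists {x. degree x \<in> G}"
    and a: "\<And>i g. g \<in> G \<Longrightarrow> a i g \<in> finest_component r g" and "i < 2 * r" "j < 2 * r"
  shows "poly_val (ut_alg (2 * r)) (symplectic_inv r) a p \<in> carrier (ut_alg (2 * r)) \<and>
    poly_val (ut_alg (2 * r)) (symplectic_inv r) a p $$ (i, j) =
    eval_sum (\<lambda>w. word_entry (2 * r) (\<lambda>x. letter_entry r (($$) (a (index x) (degree x))) (starred x)) w i j) p"
proof -
  interpret vectorspace class_ring "ut_alg (2 * r) :: ('k, 'k mat) module" by (rule vectorspace_ut_alg)
  let ?w = "word_val (ut_alg (2 * r)) (symplectic_inv r) a"
  have w: "?w w \<in> carrier (ut_alg (2 * r))"
    "?w w $$ (i, j) = word_entry (2 * r) (\<lambda>x. letter_entry r (($$) (a (index x) (degree x))) (starred x)) w i j"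
    if "w \<in> Poly_Mapping.keys p" for w
  proof -
    have "a i g \<in> carrier (ut_alg (2 * r))" if "g \<in> degree ` set w" for i g
      using that \<open>w \<in> Poly_Mapping.keys p\<close> keys by (intro finest_componentD(1)[OF a]) auto
    from word_val_index[of w a r, OF this] assms(3,4)
    show "?w w \<in> carrier (ut_alg (2 * r))"
      "?w w $$ (i, j) = word_entry (2 * r) (\<lambda>x. letter_entry r (($$) (a (index x) (degree x))) (starred x)) w i j"
      by blast+
  qed
  have c: "Poly_Mapping.lookup p w \<odot>\<^bsub>ut_alg (2 * r)\<^esub> ?w w \<in> carrier (ut_alg (2 * r))"
    if "w \<in> Poly_Mapping.keys p" for w
    using w(1)[OF that] by (intro smult_closed) auto
  have "(Poly_Mapping.lookup p w \<odot>\<^bsub>ut_alg (2 * r)\<^esub> ?w w) $$ (i, j) = Poly_Mapping.lookup p w * ?w w $$ (i, j)"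
    if "w \<in> Poly_Mapping.keys p" for w
    using w(1)[OF that] assms(3,4) by (auto simp: ut_alg_simps)
  then show ?thesis
    using finsum_ut_alg_index[of "Poly_Mapping.keys p" "\<lambda>w. Poly_Mapping.lookup p w \<odot>\<^bsub>ut_alg (2 * r)\<^esub> ?w w"
        "2 * r" i j, OF c assms(3,4) finite_keys] w(2)
    by (simp add: poly_val_def eval_sum_def)
qed

section \<open>The functionals that detect identities\<close>

definition basis_subst :: "nat \<Rightarrow> (nat \<Rightarrow> nat \<times> nat) \<Rightarrow> nat \<Rightarrow> int vec \<Rightarrow> 'k::field mat" where
  "basis_subst r b i g = (if b i \<in> pairs (2 * r) \<and> pair_degree r (b i) = g
     then elem_mat (2 * r) (fst (b i)) (snd (b i)) else 0\<^sub>m (2 * r) (2 * r))"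

lemma basis_subst_in_component: "basis_subst r b i g \<in> (finest_component r g :: 'k::field mat set)"
proof (cases "b i \<in> pairs (2 * r) \<and> pair_degree r (b i) = g")
  case True
  then show ?thesis using elem_mat_in_finest_component[of "b i" r] by (auto simp: basis_subst_def)
next
  case False
  then have "basis_subst r b i g = (0\<^sub>m (2 * r) (2 * r) :: 'k mat)" unfolding basis_subst_def by (rule if_not_P)
  then show ?thesis by (simp add: finest_component_zero)
qed

lemma word_entry_basis_subst:
  assumes "p < 2 * r"
  shows "word_entry (2 * r) (\<lambda>x. letter_entry r (($$) (basis_subst r b (index x) (degree x))) (starred x)) w p q
    = (word_entry (2 * r) (basis_letter r b) w p q :: 'k::field)"
proof (rule word_entry_cong[OF _ assms])
  fix x :: "int vec indet" and p l assume pl: "p < 2 * r" "l < 2 * r"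
  have "basis_subst r b i g $$ (u, v) = (unit_entry r (b i) g (u, v) :: 'k)" if "u < 2 * r" "v < 2 * r" for i g u v
    using that by (cases "b i") (auto simp: basis_subst_def unit_entry_def elem_mat_def)
  then show "letter_entry r (($$) (basis_subst r b (index x) (degree x))) (starred x) (p, l) = (basis_letter r b x (p, l) :: 'k)"
    using pl by (simp add: letter_entry_def basis_letter_def mirror_def)
qed

text \<open>The bound is one less than the number of steps from 0 to 2r - 1. Which of these maps
  give nonzero values is left open, as a bound for their number suffices.\<close>

definition low_colourings :: "nat \<Rightarrow> nat \<Rightarrow> (nat \<Rightarrow> nat \<times> nat) set" where
  "low_colourings r n =
     {b \<in> {1..n} \<rightarrow>\<^sub>E pairs (2 * r). card {i \<in> {1..n}. off_diagonal (b i)} \<le> 2 * r - 2}"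

text \<open>The functionals that may be nonzero: \<open>(b, i, j)\<close> stands for the entry \<open>(i, j)\<close> of the value under
  \<open>basis_subst r b\<close>.\<close>

definition functional_index :: "nat \<Rightarrow> nat \<Rightarrow> ((nat \<Rightarrow> nat \<times> nat) \<times> nat \<times> nat) set" where
  "functional_index r n =
     full_colourings r n \<times> {(0, 2 * r - 1)} \<union> low_colourings r n \<times> ({..<2 * r} \<times> {..<2 * r})"

text \<open>In one direction, substitutions of matrix units are graded. In the other, functionals
  outside the index set vanish on every multilinear word by \<open>full_colouring_of_path\<close>,
  and by \<open>word_entry_expand\<close> any graded substitution gives a combination of the
  functionals of matrix units.\<close>

lemma identity_iff:
  fixes p :: "int vec indet list \<Rightarrow>\<^sub>0 'k::field"
  assumes "r \<ge> 1" and p: "p \<in> multilinear_polys (carrier_vec r) n"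
  shows "p \<in> graded_star_identities (carrier_vec r) (ut_alg (2 * r)) (finest_component r) (symplectic_inv r) \<longleftrightarrow>
    (\<forall>(b, i, j)\<in>functional_index r n. eval_sum (\<lambda>w. word_entry (2 * r) (basis_letter r b) w i j) p = 0)"
proof
  let ?G = "carrier_vec r :: int vec set"
  have words: "Poly_Mapping.keys p \<subseteq> multilinear_words ?G n" by (rule keys_multilinear_polys[OF p])
  then have keys: "Poly_Mapping.keys p \<subseteq> lists {x. degree x \<in> ?G}"
    by (rule subset_trans[OF _ multilinear_words_subset])
  {
    assume id: "p \<in> graded_star_identities ?G (ut_alg (2 * r)) (finest_component r) (symplectic_inv r)"
    show "\<forall>(b, i, j)\<in>functional_index r n. eval_sum (\<lambda>w. word_entry (2 * r) (basis_letter r b) w i j) p = 0"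
    proof (rule ballI, unfold split_paired_all, unfold prod.case)
      fix b i j assume "(b, i, j) \<in> functional_index r n"
      then have ij: "i < 2 * r" "j < 2 * r" using assms(1) by (auto simp: functional_index_def)
      have "poly_val (ut_alg (2 * r)) (symplectic_inv r) (basis_subst r b) p = \<zero>\<^bsub>ut_alg (2 * r)\<^esub>"
      proof -
        have "\<forall>a. (\<forall>i. \<forall>g\<in>?G. a i g \<in> finest_component r g) \<longrightarrow>
            poly_val (ut_alg (2 * r)) (symplectic_inv r) a p = \<zero>\<^bsub>ut_alg (2 * r)\<^esub>"
          using id by (simp add: graded_star_identities_def)
        from spec[OF this, of "basis_subst r b"] show ?thesis by (simp add: basis_subst_in_component)
      qed
      then have "poly_val (ut_alg (2 * r)) (symplectic_inv r) (basis_subst r b) p $$ (i, j) = 0"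
        using ij by (simp add: ut_alg_simps)
      then show "eval_sum (\<lambda>w. word_entry (2 * r) (basis_letter r b) w i j) p = 0"
        using poly_val_index[where a = "basis_subst r b", OF keys basis_subst_in_component ij]
        by (simp add: word_entry_basis_subst[OF ij(1)])
    qed
  }
  assume zero: "\<forall>(b, i, j)\<in>functional_index r n. eval_sum (\<lambda>w. word_entry (2 * r) (basis_letter r b) w i j) p = 0"
  have all_zero: "eval_sum (\<lambda>w. word_entry (2 * r) (basis_letter r b) w i j) p = 0"
    if b: "b \<in> {1..n} \<rightarrow>\<^sub>E pairs (2 * r)" and ij: "i < 2 * r" "j < 2 * r" for b i j
  proof (cases "(b, i, j) \<in> functional_index r n")
    case True
    then show ?thesis using zero by blast
  next
    case False
    have "word_entry (2 * r) (basis_letter r b) w i j = (0 :: 'k)" if w: "w \<in> Poly_Mapping.keys p" for w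
    proof (rule ccontr)
      assume nz: "word_entry (2 * r) (basis_letter r b) w i j \<noteq> (0 :: 'k)"
      have "b \<notin> low_colourings r n" using False ij by (auto simp: functional_index_def)
      then have "2 * r - 1 \<le> card {i \<in> {1..n}. off_diagonal (b i)}"
        using b by (simp add: low_colourings_def)
      from full_colouring_of_path[OF assms(1) subsetD[OF words w] ij nz b this] False
      show False by (auto simp: functional_index_def)
    qed
    then show ?thesis by (simp add: eval_sum_def)
  qed
  have "poly_val (ut_alg (2 * r)) (symplectic_inv r) a p = \<zero>\<^bsub>ut_alg (2 * r)\<^esub>"
    if a: "\<forall>i. \<forall>g\<in>?G. a i g \<in> finest_component r g" for a :: "nat \<Rightarrow> int vec \<Rightarrow> 'k mat"
  proof -
    let ?c = "\<lambda>b. \<Prod>i\<in>{1..n}. a i (pair_degree r (b i)) $$ b i"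
    have ag: "a i g \<in> finest_component r g" if "g \<in> ?G" for i g using a that by blast
    have ent: "poly_val (ut_alg (2 * r)) (symplectic_inv r) a p $$ (i, j) = 0" if ij: "i < 2 * r" "j < 2 * r" for i j
    proof -
      have "word_entry (2 * r) (\<lambda>x. letter_entry r (($$) (a (index x) (degree x))) (starred x)) w i j =
          (\<Sum>b\<in>{1..n} \<rightarrow>\<^sub>E pairs (2 * r). ?c b * word_entry (2 * r) (basis_letter r b) w i j)"
        if "w \<in> Poly_Mapping.keys p" for w
      proof -
        have w: "distinct (map index w)" "index ` set w = {1..n}" "degree ` set w \<subseteq> ?G"
          using words that by (auto simp: multilinear_words_def)
        have "P \<in> pairs (2 * r) \<and> pair_degree r P = g"
          if "g \<in> degree ` set w" "P \<in> {..<2 * r} \<times> {..<2 * r}" "a i g $$ P \<noteq> 0" for i g P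
        proof -
          have agi: "a i g \<in> finest_component r g" using w(3) that(1) by (intro ag) blast
          have "upper_triangular (a i g)" "a i g \<in> carrier_mat (2 * r) (2 * r)"
            using finest_componentD(1)[OF agi] by (auto simp: ut_alg_simps)
          then have "fst P \<le> snd P"
            using that(2,3) upper_triangularD[of "a i g" "snd P" "fst P"] by (cases P) (auto simp: not_le[symmetric])
          then have "P \<in> pairs (2 * r)" using that(2) by (auto simp: pairs_def)
          then show ?thesis using finest_componentD(2)[OF agi _ that(3)] by blast
        qed
        from word_entry_expand[OF this w(1) ij] show ?thesis unfolding w(2) by simp
      qed
      then have "eval_sum (\<lambda>w. word_entry (2 * r) (\<lambda>x. letter_entry r (($$) (a (index x) (degree x))) (starred x)) w i j) p
          = (\<Sum>w\<in>Poly_Mapping.keys p. \<Sum>b\<in>{1..n} \<rightarrow>\<^sub>E pairs (2 * r).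
              ?c b * (Poly_Mapping.lookup p w * word_entry (2 * r) (basis_letter r b) w i j))"
        unfolding eval_sum_def by (intro sum.cong refl) (simp add: sum_distrib_left mult_ac)
      also have "\<dots> = (\<Sum>b\<in>{1..n} \<rightarrow>\<^sub>E pairs (2 * r).
          ?c b * eval_sum (\<lambda>w. word_entry (2 * r) (basis_letter r b) w i j) p)"
        by (subst sum.swap) (simp add: eval_sum_def sum_distrib_left)
      also have "\<dots> = 0" using all_zero ij by (intro sum.neutral ballI) simp
      finally show ?thesis using poly_val_index[OF keys ag ij] by simp
    qed
    \<comment> \<open>\<open>poly_val_index\<close> yields the dimensions of the value only along
      with a valid entry; (0, 0) serves as one.\<close>
    have "0 < 2 * r" using assms(1) by simp
    from poly_val_index[OF keys ag this this]
    have "poly_val (ut_alg (2 * r)) (symplectic_inv r) a p \<in> carrier_mat (2 * r) (2 * r)" by (simp add: ut_alg_simps)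
    then show ?thesis using ent by (intro eq_matI) (auto simp: ut_alg_simps)
  qed
  then show "p \<in> graded_star_identities ?G (ut_alg (2 * r)) (finest_component r) (symplectic_inv r)"
    using keys unfolding graded_star_identities_def free_alg_simps by (intro CollectI conjI allI impI) simp_all
qed

section \<open>Bounds for the codimension and their size\<close>

lemma finite_functional_index:
  "finite (full_colourings r n)" "finite (low_colourings r n)" "finite (functional_index r n)"
proof -
  show full: "finite (full_colourings r n)" unfolding full_colourings_def
    by (rule card_colourings(1))
      (auto simp: diagonal_def step_class_def dest: step_class_disjoint)
  have "finite ({1..n} \<rightarrow>\<^sub>E pairs (2 * r))" by (intro finite_PiE) auto
  then show low: "finite (low_colourings r n)"
    by (rule rev_finite_subset) (auto simp: low_colourings_def)
  show "finite (functional_index r n)" using full low by (simp add: functional_index_def)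
qed

lemma card_full_colourings:
  "card (full_colourings r n) = num_colourings (2 * r) (\<lambda>j. card (step_class r j)) (step_mult r) r n"
proof -
  have "card (diagonal m) = m" for m
    by (simp add: diagonal_def card_image inj_on_def)
  moreover have "card (full_colourings r n) =
      num_colourings (card (diagonal (2 * r))) (\<lambda>j. card (step_class r j)) (step_mult r) r (card {1..n})"
    unfolding full_colourings_def
  proof (rule card_colourings(2))
    show "diagonal (2 * r) \<inter> step_class r j = {}" if "j < r" for j
      using step_class_off_diagonal[OF that] by (force simp: diagonal_def)
  qed (auto simp: diagonal_def step_class_def dest: step_class_disjoint)
  ultimately show ?thesis by simp
qed

lemma sum_step_mult: "r \<ge> 1 \<Longrightarrow> (\<Sum>j<r. step_mult r j) = 2 * r - 1"
proof -
  assume "r \<ge> 1"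
  then obtain s where s: "r = Suc s" by (cases r) auto
  have "(\<Sum>j<s. step_mult r j) = (\<Sum>j<s. 2)" by (intro sum.cong) (auto simp: step_mult_def s)
  then show ?thesis by (simp add: s step_mult_def)
qed

lemma full_colouring_off_diagonal:
  assumes "r \<ge> 1" "b \<in> full_colourings r n"
  shows "card {i \<in> {1..n}. off_diagonal (b i)} = 2 * r - 1"
proof -
  let ?S = "\<lambda>j. {i \<in> {1..n}. b i \<in> step_class r j}"
  have b: "b i \<in> diagonal (2 * r) \<union> (\<Union>j<r. step_class r j)" if "i \<in> {1..n}" for i
  proof -
    have "b \<in> {1..n} \<rightarrow>\<^sub>E diagonal (2 * r) \<union> (\<Union>j<r. step_class r j)"
      using assms(2) by (simp add: full_colourings_def colourings_def)
    from PiE_mem[OF this that] show ?thesis .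
  qed
  have "off_diagonal (b i) \<longleftrightarrow> (\<exists>j<r. b i \<in> step_class r j)" if "i \<in> {1..n}" for i
  proof
    assume "off_diagonal (b i)"
    then have "b i \<notin> diagonal (2 * r)" by (auto simp: diagonal_def)
    then show "\<exists>j<r. b i \<in> step_class r j" using b[OF that] by blast
  qed (use step_class_off_diagonal in blast)
  then have "{i \<in> {1..n}. off_diagonal (b i)} = (\<Union>j<r. ?S j)" by blast
  also have "card \<dots> = (\<Sum>j<r. card (?S j))"
  proof (rule card_UN_disjoint)
    show "\<forall>i\<in>{..<r}. \<forall>j\<in>{..<r}. i \<noteq> j \<longrightarrow> ?S i \<inter> ?S j = {}"
    proof (intro ballI impI)
      fix i j assume "i \<in> {..<r}" "j \<in> {..<r}" "i \<noteq> j"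
      then have "step_class r i \<inter> step_class r j = {}"
        using step_class_disjoint[of i j r] step_class_disjoint[of j i r] by (cases "i < j") auto
      then show "?S i \<inter> ?S j = {}" by blast
    qed
  qed auto
  also have "\<dots> = (\<Sum>j<r. step_mult r j)"
    using assms(2) by (intro sum.cong) (auto simp: full_colourings_def colourings_def)
  finally show ?thesis using sum_step_mult[OF assms(1)] by simp
qed

text \<open>The upper bound is the number of functionals. For the lower bound, each full colouring
  \<open>b\<close> has a word \<open>w b\<close> that does not vanish under it and, by uniqueness,
  vanishes under all other full colourings. So these monomials are dual to the functionals up to
  nonzero factors.\<close>

lemma codim_bounds:
  assumes "r \<ge> 1"
  defines "c \<equiv> graded_star_codim (carrier_vec r) (ut_alg (2 * r) :: ('k::field, 'k mat) module)
    (finest_component r) (symplectic_inv r)"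
  shows "card (full_colourings r n) \<le> c n"
    and "c n \<le> card (full_colourings r n) + card (low_colourings r n) * (2 * r)\<^sup>2"
proof -
  let ?G = "carrier_vec r :: int vec set"
  let ?P = "multilinear_polys ?G n :: (int vec indet list \<Rightarrow>\<^sub>0 'k) set"
  let ?T = "graded_star_identities ?G (ut_alg (2 * r) :: ('k, 'k mat) module) (finest_component r) (symplectic_inv r)"
  let ?V = "free_alg ?G \<lparr>carrier := ?P\<rparr>"
  define f :: "(nat \<Rightarrow> nat \<times> nat) \<times> nat \<times> nat \<Rightarrow> (int vec indet list \<Rightarrow>\<^sub>0 'k) \<Rightarrow> 'k"
    where "f = (\<lambda>(b, i, j). eval_sum (\<lambda>w. word_entry (2 * r) (basis_letter r b) w i j))"
  interpret A: vectorspace class_ring "free_alg ?G :: ('k, int vec indet list \<Rightarrow>\<^sub>0 'k) module"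
    by (rule vectorspace_free_alg)
  have "vectorspace class_ring ?V"
    by (rule A.subspace_is_vs)
      (intro subspace.intro vectorspace_free_alg submodule_multilinear_polys)
  then interpret V: common_kernel ?V "functional_index r n" f "?P \<inter> ?T"
  proof (intro common_kernel.intro common_kernel_axioms.intro)
    show "finite (functional_index r n)" by (rule finite_functional_index)
    show "f \<iota> (v \<oplus>\<^bsub>?V\<^esub> w) = f \<iota> v + f \<iota> w" for \<iota> v w
      by (simp add: f_def case_prod_beta free_alg_simps eval_sum_add)
    show "f \<iota> (c \<odot>\<^bsub>?V\<^esub> v) = c * f \<iota> v" for \<iota> c v
      by (simp add: f_def case_prod_beta free_alg_simps eval_sum_scale)
    have "v \<in> ?T \<longleftrightarrow> (\<forall>\<iota>\<in>functional_index r n. f \<iota> v = 0)" if "v \<in> ?P" for v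
      unfolding identity_iff[OF assms(1) that] f_def by (simp add: case_prod_beta)
    then show "?P \<inter> ?T = {v \<in> carrier ?V. \<forall>\<iota>\<in>functional_index r n. f \<iota> v = 0}" by auto
  qed
  have c: "c n = VectorSpace.vectorspace.dim class_ring (quotient_space ?V (?P \<inter> ?T))"
    by (simp add: c_def graded_star_codim_def)
  let ?J = "full_colourings r n \<times> {(0 :: nat, 2 * r - 1)}"
  define w where "w b = (SOME w. w \<in> multilinear_words ?G n \<and>
    word_entry (2 * r) (basis_letter r b) w 0 (2 * r - 1) \<noteq> (0 :: 'k))" for b
  have w: "w b \<in> multilinear_words ?G n \<and> word_entry (2 * r) (basis_letter r b) (w b) 0 (2 * r - 1) \<noteq> (0 :: 'k)"
    if "b \<in> full_colourings r n" for b
  proof -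
    have "\<exists>w. w \<in> multilinear_words ?G n \<and> word_entry (2 * r) (basis_letter r b) w 0 (2 * r - 1) \<noteq> (0 :: 'k)"
      using ex_word_of_full_colouring[OF assms(1) that, where 'k = 'k] by (simp only: Bex_def)
    then show ?thesis unfolding w_def by (rule someI_ex)
  qed
  have "card ?J \<le> VectorSpace.vectorspace.dim class_ring (quotient_space ?V (?P \<inter> ?T))"
  proof (rule V.dim_quotient_ge[where v = "\<lambda>\<iota>. Poly_Mapping.single (w (fst \<iota>)) 1"])
    show "?J \<subseteq> functional_index r n" by (simp add: functional_index_def)
    fix \<iota> assume \<iota>: "\<iota> \<in> ?J"
    show "Poly_Mapping.single (w (fst \<iota>)) 1 \<in> carrier ?V"
    proof -
      have "fst \<iota> \<in> full_colourings r n" using \<iota> by auto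
      from single_in_multilinear_polys[OF conjunct1[OF w[OF this]]] show ?thesis by simp
    qed
    show "f \<iota> (Poly_Mapping.single (w (fst \<iota>)) 1) \<noteq> 0"
      using w \<iota> by (auto simp: f_def)
    fix \<iota>' assume \<iota>': "\<iota>' \<in> ?J" and ne: "\<iota>' \<noteq> \<iota>"
    obtain b b' where b: "\<iota> = (b, 0, 2 * r - 1)" "b \<in> full_colourings r n"
      "\<iota>' = (b', 0, 2 * r - 1)" "b' \<in> full_colourings r n"
      using \<iota> \<iota>' by auto
    show "f \<iota>' (Poly_Mapping.single (w (fst \<iota>)) 1) = 0"
    proof (rule ccontr)
      assume "f \<iota>' (Poly_Mapping.single (w (fst \<iota>)) 1) \<noteq> 0"
      then have nz: "word_entry (2 * r) (basis_letter r b') (w b) 0 (2 * r - 1) \<noteq> (0 :: 'k)"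
        by (simp add: f_def b)
      have "b = b'"
        by (rule full_colouring_unique[OF assms(1) conjunct1[OF w[OF b(2)]] b(2) conjunct2[OF w[OF b(2)]]
              b(4) nz full_colouring_off_diagonal[OF assms(1) b(2)]])
      then show False using ne b by simp
    qed
  qed
  then show "card (full_colourings r n) \<le> c n" by (simp add: c card_cartesian_product)
  have "c n \<le> card (functional_index r n)" unfolding c by (rule V.dim_quotient_le)
  also have "\<dots> \<le> card ?J + card (low_colourings r n \<times> ({..<2 * r} \<times> {..<2 * r}))"
    unfolding functional_index_def by (rule card_Un_le)
  finally show "c n \<le> card (full_colourings r n) + card (low_colourings r n) * (2 * r)\<^sup>2"
    by (simp add: card_cartesian_product power2_eq_square)
qed

text \<open>The off-diagonal positions are treated as one single class used exactly t times, so that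
  the same count and its asymptotics apply.\<close>

lemma card_low_colourings:
  "card (low_colourings r n) \<le>
     (\<Sum>t\<le>2 * r - 2. num_colourings (2 * r) (\<lambda>_. card {P \<in> pairs (2 * r). off_diagonal P}) (\<lambda>_. t) 1 n)"
proof -
  let ?C = "{P \<in> pairs (2 * r). off_diagonal P}"
  let ?L = "\<lambda>t. colourings {1..n} (diagonal (2 * r)) (\<lambda>_. ?C) (\<lambda>_. t) 1"
  have pairs: "pairs (2 * r) = diagonal (2 * r) \<union> ?C"
    by (auto simp: pairs_def diagonal_def)
  have card_L: "card (?L t) = num_colourings (2 * r) (\<lambda>_. card ?C) (\<lambda>_. t) 1 n" for t
  proof -
    have "card (diagonal (2 * r)) = 2 * r" by (simp add: diagonal_def card_image inj_on_def)
    moreover have "card (?L t) = num_colourings (card (diagonal (2 * r))) (\<lambda>_. card ?C) (\<lambda>_. t) 1 (card {1..n})"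
      by (rule card_colourings(2)) (auto simp: diagonal_def)
    ultimately show ?thesis by simp
  qed
  have fin: "finite (?L t)" for t
    by (rule card_colourings(1)) (auto simp: diagonal_def)
  have "low_colourings r n \<subseteq> (\<Union>t\<le>2 * r - 2. ?L t)"
  proof
    fix b assume b: "b \<in> low_colourings r n"
    let ?t = "card {i \<in> {1..n}. off_diagonal (b i)}"
    have mem: "b \<in> {1..n} \<rightarrow>\<^sub>E pairs (2 * r)" and t: "?t \<le> 2 * r - 2" using b by (auto simp: low_colourings_def)
    have "{i \<in> {1..n}. b i \<in> ?C} = {i \<in> {1..n}. off_diagonal (b i)}"
      using PiE_mem[OF mem] by blast
    moreover have "(\<Union>j<1::nat. ?C) = ?C" by auto
    then have "b \<in> {1..n} \<rightarrow>\<^sub>E diagonal (2 * r) \<union> (\<Union>j<1::nat. ?C)"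
      using mem pairs by (simp only:)
    ultimately have "b \<in> ?L ?t" unfolding colourings_def by simp
    then show "b \<in> (\<Union>t\<le>2 * r - 2. ?L t)" using t by blast
  qed
  then have "card (low_colourings r n) \<le> card (\<Union>t\<le>2 * r - 2. ?L t)"
    using fin by (intro card_mono) auto
  also have "\<dots> \<le> (\<Sum>t\<le>2 * r - 2. card (?L t))" by (rule card_UN_le) simp
  finally show ?thesis by (simp only: card_L)
qed

text \<open>Each of the r - 1 noncentral classes contributes 2^2 / (2! (2r)^2) = 1 / (2 r^2), and
  the central one contributes 1 / (2r).\<close>

lemma prod_step_mult:
  assumes "r \<ge> 1"
  shows "(\<Prod>j<r. real (card (step_class r j)) ^ step_mult r j / (fact (step_mult r j) * real (2 * r) ^ step_mult r j))
    = 1 / (2 ^ r * real r ^ (2 * r - 1))"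
proof -
  define x where "x = real r"
  obtain s where s: "r = Suc s" using assms by (cases r) auto
  have t: "real (card (step_class r j)) ^ step_mult r j / (fact (step_mult r j) * real (2 * r) ^ step_mult r j)
      = (if j = s then 1 / (2 * x) else 1 / (2 * x ^ 2))" if "j < r" for j
  proof -
    have mult: "step_mult r j = (if j = s then 1 else 2)" by (simp add: step_mult_def s)
    have x: "real (2 * r) = 2 * x" by (simp add: x_def)
    show ?thesis unfolding card_step_class[OF that] mult x by (simp add: power_mult_distrib)
  qed
  have "(\<Prod>j<r. real (card (step_class r j)) ^ step_mult r j / (fact (step_mult r j) * real (2 * r) ^ step_mult r j))
      = (\<Prod>j<r. if j = s then 1 / (2 * x) else 1 / (2 * x ^ 2))"
    by (intro prod.cong refl t) simp
  also have "\<dots> = (\<Prod>j<s. if j = s then 1 / (2 * x) else 1 / (2 * x ^ 2)) * (1 / (2 * x))"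
    by (simp add: s)
  also have "(\<Prod>j<s. if j = s then 1 / (2 * x) else 1 / (2 * x ^ 2)) = (\<Prod>j<s. 1 / (2 * x ^ 2))"
    by (intro prod.cong) auto
  also have "\<dots> * (1 / (2 * x)) = 1 / (2 ^ r * x ^ (2 * r - 1))"
    by (simp add: s power_divide power_mult_distrib power_mult[symmetric])
  finally show ?thesis by (simp add: x_def)
qed

lemma power_times_geometric_smallo:
  assumes "t < M" "q > (0 :: real)"
  shows "(\<lambda>n. real n ^ t * q ^ n) \<in> o(\<lambda>n. real n ^ M * q ^ n)"
proof -
  have "(\<lambda>n. real n ^ t) \<in> o(\<lambda>n. real n ^ M)"
    using assms(1) by real_asymp
  then show ?thesis by (rule landau_o.small.mult_right)
qed

lemma asymp_equiv_num_colourings_one: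
  assumes "d > 0"
  shows "(\<lambda>n. real (num_colourings d (\<lambda>_. m) (\<lambda>_. t) 1 n)) \<sim>[sequentially]
    (\<lambda>n. real m ^ t / (fact t * real d ^ t) * (real n ^ t * real d ^ n))"
proof -
  have "(\<Prod>j<1::nat. real m ^ t / (fact t * real d ^ t)) = real m ^ t / (fact t * real d ^ t)"
    "(\<Sum>j<1::nat. t) = t" by simp_all
  with asymp_equiv_num_colourings[OF assms, of "\<lambda>_. m" "\<lambda>_. t" 1] show ?thesis
    by (simp only: mult.assoc)
qed

theorem theorem2p26:
  fixes r :: nat and A :: "('k::field_char_0, 'k mat) module" and c :: "nat \<Rightarrow> nat"
  assumes "r \<ge> 1"
    and "A = ut_alg (2 * r)"
    and "c = graded_star_codim (carrier_vec r) A (finest_component r) (symplectic_inv r)"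
  shows "(\<lambda>n. real (c n)) \<sim>[sequentially]
           (\<lambda>n. (1 / (2 ^ r * real r ^ (2 * r - 1))) * real n ^ (2 * r - 1) * real (2 * r) ^ n) \<and>
         convergent (\<lambda>n. root n (real (c n))) \<and>
         graded_star_exp (carrier_vec r) A (finest_component r) (symplectic_inv r) = real (2 * r)"
proof -
  let ?K = "1 / (2 ^ r * real r ^ (2 * r - 1))" and ?M = "2 * r - 1" and ?q = "real (2 * r)"
  let ?T = "\<lambda>n. ?K * real n ^ ?M * ?q ^ n"
  let ?full = "\<lambda>n. real (card (full_colourings r n))" and ?low = "\<lambda>n. real (card (low_colourings r n) * (2 * r)\<^sup>2)"
  have q: "2 * r > 0" "?q > 0" using assms(1) by auto
  have K: "?K > 0" using assms(1) by simp
  have full: "?full \<sim>[sequentially] ?T"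
    using asymp_equiv_num_colourings[OF q(1), of "\<lambda>j. card (step_class r j)" "step_mult r" r]
    unfolding card_full_colourings prod_step_mult[OF assms(1)] sum_step_mult[OF assms(1)] .
  \<comment> \<open>The comparison function without its leading constant, which does not affect
    small-o.\<close>
  define g where "g n = real n ^ ?M * ?q ^ n" for n
  have T: "?T = (\<lambda>n. ?K * g n)" by (simp only: g_def mult.assoc)
  \<comment> \<open>The power of n is t < 2r - 1, against the same geometric factor.\<close>
  have low_t: "(\<lambda>n. real (num_colourings (2 * r) (\<lambda>_. m) (\<lambda>_. t) 1 n)) \<in> o(g)"
    if "t \<le> 2 * r - 2" for t m
  proof -
    let ?c = "real m ^ t / (fact t * ?q ^ t)"
    have "(\<lambda>n. real (num_colourings (2 * r) (\<lambda>_. m) (\<lambda>_. t) 1 n)) \<sim>[sequentially]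
        (\<lambda>n. ?c * (real n ^ t * ?q ^ n))"
      by (rule asymp_equiv_num_colourings_one[OF q(1)])
    then have "(\<lambda>n. real (num_colourings (2 * r) (\<lambda>_. m) (\<lambda>_. t) 1 n)) \<in> O(\<lambda>n. ?c * (real n ^ t * ?q ^ n))"
      by (rule asymp_equiv_imp_bigo)
    moreover have "(\<lambda>n. real n ^ t * ?q ^ n) \<in> o(g)"
      unfolding g_def by (rule power_times_geometric_smallo[OF _ q(2)]) (use that assms(1) in linarith)
    then have "(\<lambda>n. ?c * (real n ^ t * ?q ^ n)) \<in> o(g)"
      unfolding cmult_in_smallo_iff by (rule disjI2)
    ultimately show ?thesis by (rule landau_o.big_small_trans)
  qed
  have low: "?low \<in> o(?T)"
  proof -
    let ?m = "card {P \<in> pairs (2 * r). off_diagonal P}"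
    let ?u = "\<lambda>n. (\<Sum>t\<le>2 * r - 2. real (num_colourings (2 * r) (\<lambda>_. ?m) (\<lambda>_. t) 1 n)) * real ((2 * r)\<^sup>2)"
    have "norm (?low n) \<le> norm (?u n)" for n
    proof -
      have "?low n \<le> ?u n"
        unfolding of_nat_mult of_nat_sum[symmetric] by (intro mult_right_mono of_nat_mono card_low_colourings) simp
      moreover have "0 \<le> ?low n" by (rule of_nat_0_le_iff)
      ultimately show ?thesis unfolding real_norm_def by linarith
    qed
    then have "?low \<in> O(?u)" by (intro landau_o.big_mono[OF always_eventually] allI)
    moreover have "(\<lambda>n. \<Sum>t\<le>2 * r - 2. real (num_colourings (2 * r) (\<lambda>_. ?m) (\<lambda>_. t) 1 n)) \<in> o(g)"
      by (rule big_sum_in_smallo, rule low_t, rule iffD1[OF atMost_iff])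
    then have "?u \<in> o(g)" unfolding cmult_in_smallo_iff' by (rule disjI2)
    ultimately have "?low \<in> o(g)" by (rule landau_o.big_small_trans)
    moreover have "o(?T) = o(g)" unfolding T by (rule landau_o.small.cmult[OF less_imp_neq[OF K, symmetric]])
    ultimately show ?thesis by (simp only:)
  qed
  have upper: "(\<lambda>n. ?full n + ?low n) \<sim>[sequentially] ?T"
    unfolding asymp_equiv_add_right[OF low, of ?full] by (rule full)
  have between: "real (c n) \<in> {?full n..?full n + ?low n}" for n
  proof -
    have "card (full_colourings r n) \<le> c n"
      "c n \<le> card (full_colourings r n) + card (low_colourings r n) * (2 * r)\<^sup>2"
      unfolding assms(2,3) by (rule codim_bounds[OF assms(1)])+
    from this[THEN of_nat_mono[where 'a = real]] show ?thesis
      unfolding atLeastAtMost_iff of_nat_add by (rule conjI)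
  qed
  \<comment> \<open>The codimension lies between two sequences that are both equivalent to the
    claimed one.\<close>
  have equiv: "(\<lambda>n. real (c n)) \<sim>[sequentially] ?T"
    by (rule asymp_equiv_sandwich_real[OF full upper always_eventually]) (rule allI, rule between)
  have lim: "(\<lambda>n. root n (real (c n))) \<longlonglongrightarrow> ?q"
    by (rule root_tendsto_of_asymp_equiv[OF equiv K q(2)])
  then have "convergent (\<lambda>n. root n (real (c n)))" by (rule convergentI)
  moreover have "graded_star_exp (carrier_vec r) A (finest_component r) (symplectic_inv r) = ?q"
    unfolding graded_star_exp_def assms(3)[symmetric] by (rule limI[OF lim])
  ultimately show ?thesis using equiv by blast
qed

end
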